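(* Let $Z_\epsilon\to\mathbb{P}^1$ be a one-parameter family of rank-two vector bundles with patching $$\hat\zeta=\lambda\zeta+\epsilon Q,\qquad \hat Q=\lambda^{-2}Q.$$ \begin{itemize} \item For $\epsilon=0$, $Z_0=\mathcal O(-1)\oplus\mathcal O(2)$ and the complex moduli space of global sections comes equipped with a three-dimensional non-degenerate conformal structure, as in minitwistor theory. \item For $\epsilon\ne0$, $Z_\epsilon=\mathcal O\oplus\mathcal O(1)$ and the complex moduli space of global sections is a three-dimensional Newton-Cartan manifold (equipped with the Newton-Cartan structures induced from $\mathcal O\oplus\mathcal O(1)$ as described in the context). \end{itemize}
   Context: Cover $\mathbb{P}^1$ by $U,\hat U$ with coordinates $\lambda$ and $\hat\lambda=\lambda^{-1}$; $\mathcal O(k)$ has patching $\hat w=\lambda^{-k}w$. A vertical slash denotes restriction to a global section $X_x$, $x\in M$, $M$ the moduli space of global sections. All objects are holomorphic. General construction of induced geometry: for $Z\to\mathbb{P}^1$ with fibre coordinates $w^\mu,\hat w^\mu$, the normal bundle $N_x$ of $X_x$ has patching $\mathcal F^\mu_{\ \nu}=\frac{\partial\hat w^\mu}{\partial w^\nu}|=\hat H\,\mathrm{diag}(\lambda^{-n_1},\dots)H^{-1}$ with $H$, $\hat H$ holomorphic and invertible over $U$, $\hat U$, defined up to invertible global sections of $N_x\otimes N_x^*$ varying with $x$. The frame section is $v=H^{-1}dw|$ ($d$ is the exterior derivative on $M$ at fixed $\lambda$). Minitwistor theory: here $M$ is parametrised by $Q|=\xi\lambda^2-2z\lambda-\tilde\xi$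 and the $\mathcal O(2)$-component $e^{0'0'}\lambda^2-2e^{0'1'}\lambda-e^{1'1'}$ of the frame gives the conformal structure $[(e^{0'1'})^2+e^{0'0'}e^{1'1'}]=[dz^2+d\xi d\tilde\xi]$. Newton-Cartan structure (complex, three-dimensional): $(h,\theta,\nabla)$ with $h$ a symmetric contravariant 2-tensor of rank two, $\theta$ a closed one-form spanning its kernel, and $\nabla$ a torsion-free affine connection with $\nabla h=0$, $\nabla\theta=0$. Structures induced from $\mathcal O\oplus\mathcal O(1)$: with $w=(T,\Omega)$, $\hat T=T$, $\hat\Omega=\lambda^{-1}\Omega$, these are the triples with $\theta$ the first ($\mathcal O$-valued) component of a frame section, $\nabla$ a $\Lambda$-connection with $\nabla\theta=0$, and $h$ symmetric of rank two with $h(\theta,\cdot)=0$, $\nabla h=0$. A $\Lambda$-connection is a torsion-free connection with $\Gamma^a_{\ bc}\partial_aw^\mu|=\partial_b\partial_cw^\mu|+\sigma^\mu_{\ \nu\rho}\partial_bw^\nu|\partial_cw^\rho|$, where $\{\sigma,\hat\sigma\}$, holomorphic over $U$, $\hat U$ and symmetric in lower indices, solve $\frac{\partial^2\hat w^\mu}{\partial w^\alpha\partial w^\beta}|=-\hat\sigma^\mu_{\ \nu\rho}\mathcal F^\nu_{\ \alpha}\mathcal F^\rho_{\ \beta}+\mathcal F^\mu_{\ \eta}\sigma^\eta_{\ \alpha\beta}$. *)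

theory Defs
  imports "HOL-Analysis.Analysis"
begin

text \<open>
  A fibration over the projective line is given by its patching: over the overlap of
  \<open>U\<close> (coordinate \<open>l\<close>) and the second chart (coordinate \<open>1 / l\<close>), the fibre coordinates
  are related by \<open>what = f l w\<close>. Only the values \<open>f l\<close> with \<open>l \<noteq> 0\<close> matter. Objects over
  \<open>U\<close> and over the second chart are functions of the respective coordinate, which ranges
  over all of \<open>complex\<close>; names of objects over the second chart end in \<open>h\<close>.
\<close>

type_synonym patching = "complex \<Rightarrow> complex^2 \<Rightarrow> complex^2"

definition Zfam :: "complex \<Rightarrow> patching" where
  "Zfam \<epsilon> l u = vector [l * u $ 1 + \<epsilon> * u $ 2, u $ 2 / l ^ 2]"

definition Osum :: "int^2 \<Rightarrow> patching" where
  "Osum n l u = (\<chi> i. l powi (- (n $ i)) * u $ i)"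

definition bundle_iso ::
  "patching \<Rightarrow> patching \<Rightarrow> (complex \<Rightarrow> complex^2^2) \<Rightarrow> (complex \<Rightarrow> complex^2^2) \<Rightarrow> bool" where
  "bundle_iso f g P Ph \<longleftrightarrow>
     (\<forall>i j. (\<lambda>l. P l $ i $ j) holomorphic_on UNIV) \<and>
     (\<forall>i j. (\<lambda>l. Ph l $ i $ j) holomorphic_on UNIV) \<and>
     (\<forall>l. invertible (P l) \<and> invertible (Ph l)) \<and>
     (\<forall>l u. l \<noteq> 0 \<longrightarrow> Ph (1 / l) *v f l u = g l (P l *v u))"

definition isomorphic_bundles :: "patching \<Rightarrow> patching \<Rightarrow> bool" where
  "isomorphic_bundles f g \<longleftrightarrow> (\<exists>P Ph. bundle_iso f g P Ph)"

text \<open>A global section is represented by its restriction to \<open>U\<close>, which determines it.\<close>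

definition global_sections :: "patching \<Rightarrow> (complex \<Rightarrow> complex^2) set" where
  "global_sections f =
     {s. (\<forall>i. (\<lambda>l. s l $ i) holomorphic_on UNIV) \<and>
         (\<exists>sh. (\<forall>i. (\<lambda>k. sh k $ i) holomorphic_on UNIV) \<and>
               (\<forall>l. l \<noteq> 0 \<longrightarrow> sh (1 / l) = f l (s l)))}"

text \<open>
  For a vector bundle the moduli space of global sections is a complex vector space, and its
  complex manifold structure is the one given by linear coordinates. The section with
  coordinates \<open>x\<close> is \<open>\<lambda>l. w l x\<close>; existence of such coordinates says that the moduli space
  has complex dimension three.
\<close>

definition linear_coordinates :: "patching \<Rightarrow> (complex \<Rightarrow> complex^3 \<Rightarrow> complex^2) \<Rightarrow> bool" where
  "linear_coordinates f w \<longleftrightarrow>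
     (\<forall>l. Vector_Spaces.linear (*s) (*s) (w l)) \<and>
     bij_betw (\<lambda>x l. w l x) UNIV (global_sections f)"

text \<open>
  Holomorphy in several variables, on the moduli space and on its product with a chart of the
  projective line: real differentiability with a complex linear derivative.
\<close>

definition holomorphic_M :: "(complex^3 \<Rightarrow> complex) \<Rightarrow> bool" where
  "holomorphic_M f \<longleftrightarrow>
     (\<forall>x. \<exists>c :: complex^3. (f has_derivative (\<lambda>h. \<Sum>a\<in>UNIV. c $ a * h $ a)) (at x))"

definition holomorphic_UM :: "(complex \<Rightarrow> complex^3 \<Rightarrow> complex) \<Rightarrow> bool" where
  "holomorphic_UM f \<longleftrightarrow>
     (\<forall>l x. \<exists>c0. \<exists>c :: complex^3.
        ((\<lambda>(l, x). f l x) has_derivative (\<lambda>(k, h). c0 * k + (\<Sum>a\<in>UNIV. c $ a * h $ a)))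
          (at (l, x)))"

text \<open>Complex partial derivative in the direction of the coordinate \<open>a\<close>.\<close>

definition pd :: "'n::finite \<Rightarrow> (complex^'n \<Rightarrow> complex) \<Rightarrow> complex^'n \<Rightarrow> complex" where
  "pd a f x = deriv (\<lambda>t. f (x + axis a t)) 0"

definition dw :: "(complex \<Rightarrow> complex^3 \<Rightarrow> complex^2) \<Rightarrow> complex \<Rightarrow> complex^3 \<Rightarrow> complex^3^2" where
  "dw w l x = (\<chi> \<mu> a. pd a (\<lambda>y. w l y $ \<mu>) x)"

definition normal_patching ::
  "patching \<Rightarrow> (complex \<Rightarrow> complex^3 \<Rightarrow> complex^2) \<Rightarrow> complex \<Rightarrow> complex^3 \<Rightarrow> complex^2^2" where
  "normal_patching f w l x = (\<chi> \<mu> \<nu>. pd \<nu> (\<lambda>u. f l u $ \<mu>) (w l x))"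

definition normal_splitting ::
  "patching \<Rightarrow> (complex \<Rightarrow> complex^3 \<Rightarrow> complex^2) \<Rightarrow> int^2 \<Rightarrow>
   (complex \<Rightarrow> complex^3 \<Rightarrow> complex^2^2) \<Rightarrow> (complex \<Rightarrow> complex^3 \<Rightarrow> complex^2^2) \<Rightarrow> bool" where
  "normal_splitting f w n H Hh \<longleftrightarrow>
     (\<forall>i j. holomorphic_UM (\<lambda>l x. H l x $ i $ j)) \<and>
     (\<forall>i j. holomorphic_UM (\<lambda>l x. Hh l x $ i $ j)) \<and>
     (\<forall>l x. invertible (H l x) \<and> invertible (Hh l x)) \<and>
     (\<forall>l x. l \<noteq> 0 \<longrightarrow>
        normal_patching f w l x =
          Hh (1 / l) x ** (\<chi> i j. if i = j then l powi (- (n $ i)) else 0) ** matrix_inv (H l x))"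

definition frame_section ::
  "(complex \<Rightarrow> complex^3 \<Rightarrow> complex^2) \<Rightarrow> (complex \<Rightarrow> complex^3 \<Rightarrow> complex^2^2) \<Rightarrow>
   complex \<Rightarrow> complex^3 \<Rightarrow> complex^3^2" where
  "frame_section w H l x = matrix_inv (H l x) ** dw w l x"


subsection \<open>Conformal structures\<close>

type_synonym metric = "complex^3 \<Rightarrow> complex^3^3"

definition nondegenerate :: "metric \<Rightarrow> bool" where
  "nondegenerate g \<longleftrightarrow> (\<forall>x. invertible (g x))"

definition conformal_class :: "metric \<Rightarrow> metric set" where
  "conformal_class g =
     {g'. \<exists>\<phi>. holomorphic_M \<phi> \<and> (\<forall>x. \<phi> x \<noteq> 0) \<and> (\<forall>x. g' x = (\<chi> a b. \<phi> x * g x $ a $ b))}"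

text \<open>The symmetric bilinear form of the quadratic form \<open>e01\<^sup>2 + e00 e11\<close>.\<close>

definition minitwistor_form :: "complex^3 \<Rightarrow> complex^3 \<Rightarrow> complex^3 \<Rightarrow> complex^3^3" where
  "minitwistor_form e00 e01 e11 =
     (\<chi> a b. e01 $ a * e01 $ b + (e00 $ a * e11 $ b + e11 $ a * e00 $ b) / 2)"

text \<open>The metric read off from the \<open>\<O>(2)\<close>-valued second component of the frame section.\<close>

definition minitwistor_metric ::
  "(complex \<Rightarrow> complex^3 \<Rightarrow> complex^2) \<Rightarrow> (complex \<Rightarrow> complex^3 \<Rightarrow> complex^2^2) \<Rightarrow> metric \<Rightarrow> bool" where
  "minitwistor_metric w H g \<longleftrightarrow>
     (\<exists>e00 e01 e11 :: complex^3 \<Rightarrow> complex^3.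
        (\<forall>l x a. frame_section w H l x $ 2 $ a = e00 x $ a * l ^ 2 - 2 * e01 x $ a * l - e11 x $ a) \<and>
        (\<forall>x. g x = minitwistor_form (e00 x) (e01 x) (e11 x)))"

text \<open>
  Coordinates \<open>x = (\<xi>, z, \<xi>\<^bold>~)\<close> on the space of sections \<open>\<zeta> = 0\<close>, \<open>Q = \<xi> l\<^sup>2 - 2 z l - \<xi>\<^bold>~\<close>, and the
  metric \<open>dz\<^sup>2 + d\<xi> d\<xi>\<^bold>~\<close> in these coordinates.
\<close>

definition minitwistor_coords :: "complex \<Rightarrow> complex^3 \<Rightarrow> complex^2" where
  "minitwistor_coords l x = vector [0, x $ 1 * l ^ 2 - 2 * x $ 2 * l - x $ 3]"

definition flat_metric :: metric where
  "flat_metric x = minitwistor_form (axis 1 1) (axis 2 1) (axis 3 1)"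


subsection \<open>Newton-Cartan structures\<close>

text \<open>
  Tensor fields and connections are given by their components in global coordinates:
  \<open>h x $ a $ b\<close> is \<open>h\<^sup>a\<^sup>b\<close>, \<open>\<theta> x $ a\<close> is \<open>\<theta>\<^sub>a\<close>, and \<open>\<Gamma> x a b c\<close> is the Christoffel symbol with upper
  index \<open>a\<close> and lower indices \<open>b\<close>, \<open>c\<close>.
\<close>

type_synonym bivector_field = "complex^3 \<Rightarrow> complex^3^3"
type_synonym one_form = "complex^3 \<Rightarrow> complex^3"
type_synonym connection = "complex^3 \<Rightarrow> 3 \<Rightarrow> 3 \<Rightarrow> 3 \<Rightarrow> complex"

definition holomorphic_triple :: "bivector_field \<Rightarrow> one_form \<Rightarrow> connection \<Rightarrow> bool" where
  "holomorphic_triple h \<theta> \<Gamma> \<longleftrightarrow>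
     (\<forall>a b. holomorphic_M (\<lambda>x. h x $ a $ b)) \<and>
     (\<forall>a. holomorphic_M (\<lambda>x. \<theta> x $ a)) \<and>
     (\<forall>a b c. holomorphic_M (\<lambda>x. \<Gamma> x a b c))"

definition symmetric_rank_two :: "bivector_field \<Rightarrow> bool" where
  "symmetric_rank_two h \<longleftrightarrow> (\<forall>x. transpose (h x) = h x \<and> rank (h x) = 2)"

definition torsion_free :: "connection \<Rightarrow> bool" where
  "torsion_free \<Gamma> \<longleftrightarrow> (\<forall>x a b c. \<Gamma> x a b c = \<Gamma> x a c b)"

definition closed_form :: "one_form \<Rightarrow> bool" where
  "closed_form \<theta> \<longleftrightarrow> (\<forall>x b c. pd b (\<lambda>y. \<theta> y $ c) x = pd c (\<lambda>y. \<theta> y $ b) x)"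

definition parallel_form :: "connection \<Rightarrow> one_form \<Rightarrow> bool" where
  "parallel_form \<Gamma> \<theta> \<longleftrightarrow>
     (\<forall>x b c. pd b (\<lambda>y. \<theta> y $ c) x - (\<Sum>a\<in>UNIV. \<Gamma> x a b c * \<theta> x $ a) = 0)"

definition parallel_bivector :: "connection \<Rightarrow> bivector_field \<Rightarrow> bool" where
  "parallel_bivector \<Gamma> h \<longleftrightarrow>
     (\<forall>x c a b. pd c (\<lambda>y. h y $ a $ b) x
        + (\<Sum>d\<in>UNIV. \<Gamma> x a c d * h x $ d $ b) + (\<Sum>d\<in>UNIV. \<Gamma> x b c d * h x $ a $ d) = 0)"

definition newton_cartan :: "bivector_field \<Rightarrow> one_form \<Rightarrow> connection \<Rightarrow> bool" where
  "newton_cartan h \<theta> \<Gamma> \<longleftrightarrow>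
     holomorphic_triple h \<theta> \<Gamma> \<and> symmetric_rank_two h \<and>
     closed_form \<theta> \<and> (\<forall>x. \<theta> x \<noteq> 0 \<and> {\<alpha>. h x *v \<alpha> = 0} = {c *s \<theta> x | c. True}) \<and>
     torsion_free \<Gamma> \<and> parallel_bivector \<Gamma> h \<and> parallel_form \<Gamma> \<theta>"

text \<open>\<open>\<sigma> l x \<mu> \<nu> \<rho>\<close> has upper index \<open>\<mu>\<close> and lower indices \<open>\<nu>\<close>, \<open>\<rho>\<close>.\<close>

definition sigma_splitting ::
  "patching \<Rightarrow> (complex \<Rightarrow> complex^3 \<Rightarrow> complex^2) \<Rightarrow>
   (complex \<Rightarrow> complex^3 \<Rightarrow> 2 \<Rightarrow> 2 \<Rightarrow> 2 \<Rightarrow> complex) \<Rightarrow>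
   (complex \<Rightarrow> complex^3 \<Rightarrow> 2 \<Rightarrow> 2 \<Rightarrow> 2 \<Rightarrow> complex) \<Rightarrow> bool" where
  "sigma_splitting f w \<sigma> \<sigma>h \<longleftrightarrow>
     (\<forall>\<mu> \<nu> \<rho>. holomorphic_UM (\<lambda>l x. \<sigma> l x \<mu> \<nu> \<rho>) \<and> holomorphic_UM (\<lambda>l x. \<sigma>h l x \<mu> \<nu> \<rho>)) \<and>
     (\<forall>l x \<mu> \<nu> \<rho>. \<sigma> l x \<mu> \<nu> \<rho> = \<sigma> l x \<mu> \<rho> \<nu> \<and> \<sigma>h l x \<mu> \<nu> \<rho> = \<sigma>h l x \<mu> \<rho> \<nu>) \<and>
     (\<forall>l x \<mu> \<alpha> \<beta>. l \<noteq> 0 \<longrightarrow>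
        pd \<alpha> (pd \<beta> (\<lambda>u. f l u $ \<mu>)) (w l x) =
          - (\<Sum>\<nu>\<in>UNIV. \<Sum>\<rho>\<in>UNIV. \<sigma>h (1 / l) x \<mu> \<nu> \<rho> *
               normal_patching f w l x $ \<nu> $ \<alpha> * normal_patching f w l x $ \<rho> $ \<beta>)
          + (\<Sum>\<eta>\<in>UNIV. normal_patching f w l x $ \<mu> $ \<eta> * \<sigma> l x \<eta> \<alpha> \<beta>))"

definition Lambda_connection ::
  "patching \<Rightarrow> (complex \<Rightarrow> complex^3 \<Rightarrow> complex^2) \<Rightarrow> connection \<Rightarrow> bool" where
  "Lambda_connection f w \<Gamma> \<longleftrightarrow>
     torsion_free \<Gamma> \<and>
     (\<exists>\<sigma> \<sigma>h. sigma_splitting f w \<sigma> \<sigma>h \<and>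
        (\<forall>l x \<mu> b c.
           (\<Sum>a\<in>UNIV. \<Gamma> x a b c * dw w l x $ \<mu> $ a) =
             pd b (pd c (\<lambda>y. w l y $ \<mu>)) x
             + (\<Sum>\<nu>\<in>UNIV. \<Sum>\<rho>\<in>UNIV. \<sigma> l x \<mu> \<nu> \<rho> * dw w l x $ \<nu> $ b * dw w l x $ \<rho> $ c)))"

text \<open>
  The structures induced on the moduli space when the normal bundles are \<open>\<O> \<oplus> \<O>(1)\<close>. The
  first component of the frame section is \<open>\<O>\<close>-valued, that is, independent of \<open>l\<close>.
\<close>

definition induced_structures ::
  "patching \<Rightarrow> (complex \<Rightarrow> complex^3 \<Rightarrow> complex^2) \<Rightarrow>
   (bivector_field \<times> one_form \<times> connection) set" where
  "induced_structures f w =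
     {(h, \<theta>, \<Gamma>).
        holomorphic_triple h \<theta> \<Gamma> \<and>
        (\<exists>H Hh. normal_splitting f w (vector [0, 1]) H Hh \<and>
           (\<forall>l x. frame_section w H l x $ 1 = \<theta> x)) \<and>
        Lambda_connection f w \<Gamma> \<and> parallel_form \<Gamma> \<theta> \<and>
        symmetric_rank_two h \<and> (\<forall>x. h x *v \<theta> x = 0) \<and> parallel_bivector \<Gamma> h}"

end

theory Submission
  imports Defs "HOL-Complex_Analysis.Cauchy_Integral_Formula"
begin

text \<open>
  An entire function of \<open>l\<close> that equals \<open>l ^ k\<close> times an entire function of \<open>1 / l\<close> is a polynomial
  of degree at most \<open>k\<close>, by Liouville's theorem. For \<open>\<epsilon> = 0\<close> this shows that any splitting matrix
  \<open>H\<close> of the normal bundle is lower triangular with lower right entry independent of \<open>l\<close>; as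
  \<open>\<zeta>\<close> vanishes on every section, the second component of the frame is a multiple of \<open>dQ\<close> by a
  nowhere vanishing function on the moduli space, whence the conformal class.

  For \<open>\<epsilon> \<noteq> 0\<close> the bundle is trivialised to \<open>\<O> \<oplus> \<O>(1)\<close> by \<open>T = l \<zeta> + \<epsilon> Q\<close>, \<open>\<Omega> = \<zeta>\<close>. Splittings,
  frames and \<open>\<Lambda>\<close>-connections are covariant under bundle isomorphisms, so one may work with
  \<open>\<O> \<oplus> \<O>(1)\<close>. There every constant is a global section, so sections attain all values over a point;
  hence the frame has no vanishing row and \<open>\<theta>\<close> has no zeros. It is closed because it is parallel
  for a torsion-free connection, and it spans the kernel of \<open>h\<close> by rank-nullity. The flat connection,
  a constant \<open>\<theta>\<close> and a constant \<open>h\<close> form an induced structure.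
\<close>

subsection \<open>Linear algebra\<close>

lemma matrix_vector_mult_axis: "A *v axis i (1::'a::semiring_1) = column i A"
  by (simp add: vec_eq_iff column_def matrix_vector_mult_def axis_def if_distrib[of "\<lambda>x. _ * x"] cong: if_cong)

text \<open>\<open>rank\<close> is the dimension of the row space. A basis \<open>B\<close> of the
  kernel is extended to a basis \<open>C\<close> of the whole space; \<open>A\<close> is injective
  on the span of \<open>C - B\<close> and maps it onto the column space, which symmetry identifies
  with the row space.\<close>

lemma symmetric_matrix_rank_nullity:
  fixes A :: "'a::field^'n^'n"
  assumes sym: "transpose A = A"
  shows "rank A + vec.dim {v. A *v v = 0} = CARD('n)"
proof -
  let ?K = "{v. A *v v = 0}"
  have subK: "vec.subspace ?K"
    by (simp add: vec.linear_subspace_kernel)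
  obtain B where B: "B \<subseteq> ?K" "vec.independent B" "?K \<subseteq> vec.span B" "card B = vec.dim ?K"
    using vec.basis_exists by metis
  then obtain C where C: "B \<subseteq> C" "vec.independent C" "UNIV \<subseteq> vec.span C"
    using vec.maximal_independent_subset_extend[of B UNIV] by auto
  have fC: "finite C"
    using C(2) by (rule vec.finiteI_independent)
  let ?D = "C - B"
  have spanB: "vec.span B = ?K"
    using B(1,3) subK by (metis vec.span_minimal subset_antisym)
  have indD: "vec.independent ?D"
    using C(2) vec.independent_mono by blast
  have cards: "card ?D + card B = CARD('n)"
  proof -
    have "card C = CARD('n)"
      using C(2,3) by (metis vec.dim_span_eq_card_independent vec_dim_card top.extremum_uniqueI)
    then show ?thesis
      using C(1) fC by (metis add.commute card_Diff_subset card_mono finite_subset le_add_diff_inverse)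
  qed
  have sums: "{x + y |x y. x \<in> vec.span B \<and> y \<in> vec.span ?D} = UNIV"
    using vec.span_Un[of B ?D] C(1,3) by (metis Un_Diff_cancel Un_absorb1 top.extremum_uniqueI)
  \<comment> \<open>The two spans together fill the space and their dimensions add up to
    \<open>CARD('n)\<close>, so the dimension formula for sums leaves only zero for the
    intersection.\<close>
  have "vec.dim (vec.span B \<inter> vec.span ?D) = 0"
  proof -
    have "vec.dim (UNIV :: ('a^'n) set) + vec.dim (vec.span B \<inter> vec.span ?D) = vec.dim B + vec.dim ?D"
      using vec.dim_sums_Int[of "vec.span B" "vec.span ?D"] sums by simp
    then show ?thesis
      using cards vec.dim_eq_card_independent[OF B(2)] vec.dim_eq_card_independent[OF indD]
      unfolding vec_dim_card by linarith
  qed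
  then have int0: "?K \<inter> vec.span ?D \<subseteq> {0}"
    using spanB by simp
  have lin: "Vector_Spaces.linear (*s) (*s) ((*v) A)"
    by simp
  have "inj_on ((*v) A) (vec.span ?D)"
    using int0 by (subst vec.linear_inj_on_iff_eq_0[OF lin vec.subspace_span]) auto
  then have dimD: "vec.dim ((*v) A ` ?D) = card ?D"
    using vec.dim_image_eq[OF lin, of ?D] indD by (simp add: vec.dim_eq_card_independent)
  have "vec.span ((*v) A ` ?D) = range ((*v) A)"
  proof -
    have "A *v v \<in> (*v) A ` vec.span ?D" for v
    proof -
      obtain x y where xy: "v = x + y" "x \<in> ?K" "y \<in> vec.span ?D"
        using sums[THEN equalityD2, THEN subsetD, OF UNIV_I, of v] spanB by blast
      then have "A *v v = A *v y"
        by (simp add: matrix_vector_right_distrib)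
      then show ?thesis using xy(3) by blast
    qed
    then show ?thesis
      using vec.linear_span_image[OF lin, of ?D] by auto
  qed
  moreover have "range ((*v) A) = vec.span (columns A)"
  proof
    show "range ((*v) A) \<subseteq> vec.span (columns A)"
      using matrix_vector_mult_in_columnspace_gen by blast
    have "vec.subspace (range ((*v) A))"
      using lin vec.linear_subspace_image vec.subspace_UNIV by blast
    moreover have "columns A \<subseteq> range ((*v) A)"
      by (auto simp: columns_def matrix_vector_mult_axis[symmetric])
    ultimately show "vec.span (columns A) \<subseteq> range ((*v) A)"
      by (rule vec.span_minimal[rotated])
  qed
  ultimately have "vec.dim (columns A) = card ?D"
    using dimD by (metis vec.dim_span)
  moreover have "rank A = vec.dim (columns A)"
    unfolding row_rank_def_gen by (metis sym rows_transpose)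
  ultimately show ?thesis
    using cards B(4) by simp
qed

lemma span_vec_singleton: "vec.span {v} = {c *s v | c. True}"
  by (auto simp: vec.span_singleton)

text \<open>By rank-nullity in dimension three, rank two means that the kernel is a line, and a line
  containing the nonzero \<open>\<theta>\<close> is spanned by it.\<close>

lemma rank_two_kernel:
  fixes h :: "complex^3^3" and \<theta> :: "complex^3"
  assumes "transpose h = h" and "\<theta> \<noteq> 0"
  shows "rank h = 2 \<and> h *v \<theta> = 0 \<longleftrightarrow> {\<alpha>. h *v \<alpha> = 0} = {c *s \<theta> | c. True}"
proof -
  let ?K = "{\<alpha>. h *v \<alpha> = 0}"
  have subK: "vec.subspace ?K"
    by (simp add: vec.linear_subspace_kernel)
  have rn: "rank h + vec.dim ?K = 3"
    using symmetric_matrix_rank_nullity[OF assms(1)] by simp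
  have d1: "vec.dim (vec.span {\<theta>}) = 1"
    using assms(2) by (simp add: vec.dim_eq_card_independent)
  show ?thesis
    unfolding span_vec_singleton[symmetric]
  proof
    assume *: "rank h = 2 \<and> h *v \<theta> = 0"
    have "vec.span {\<theta>} \<subseteq> ?K"
      using * by (intro vec.span_minimal subK) auto
    then show "?K = vec.span {\<theta>}"
      using * rn d1 subK by (metis (no_types, lifting) vec.subspace_dim_equal vec.subspace_span
          add_left_imp_eq numeral_3_eq_3 numeral_2_eq_2 add_2_eq_Suc' One_nat_def add_Suc_right add_0_right order_refl)
  next
    assume *: "?K = vec.span {\<theta>}"
    then have "h *v \<theta> = 0"
      using vec.span_base[of \<theta> "{\<theta>}"] by blast
    moreover have "rank h = 2"
      using rn * d1 by simp
    ultimately show "rank h = 2 \<and> h *v \<theta> = 0" by simp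
  qed
qed

text \<open>\<open>h\<close> is a sum of squares of vectors annihilated by \<open>\<theta>\<close>.
  Over the complex numbers a vanishing sum of squares does not force its terms to vanish, so the
  kernel is computed componentwise.\<close>

lemma rank_two_annihilator:
  fixes \<theta> :: "complex^3"
  assumes "\<theta> \<noteq> 0"
  obtains h :: "complex^3^3" where "transpose h = h" "rank h = 2" "h *v \<theta> = 0"
proof -
  obtain k where k: "\<theta> $ k \<noteq> 0"
    using assms by (metis vec_eq_iff zero_index)
  \<comment> \<open>The \<open>u i\<close> with \<open>i \<noteq> k\<close> form a basis of the annihilator of \<open>\<theta>\<close>, and \<open>u k = 0\<close>.\<close>
  define u :: "3 \<Rightarrow> complex^3" where "u i = \<theta> $ k *s axis i 1 - \<theta> $ i *s axis k 1" for i
  define h :: "complex^3^3" where "h = (\<chi> a b. \<Sum>i\<in>UNIV. u i $ a * u i $ b)"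
  define c where "c \<alpha> i = (\<Sum>b\<in>UNIV. u i $ b * \<alpha> $ b)" for \<alpha> i
  have c: "c \<alpha> i = \<theta> $ k * \<alpha> $ i - \<theta> $ i * \<alpha> $ k" for \<alpha> i
    unfolding c_def u_def
    by (simp add: axis_def algebra_simps sum_subtractf if_distrib[of "\<lambda>x. _ * x"] sum.If_cases cong: if_cong)
  have h\<alpha>: "h *v \<alpha> = (\<Sum>i\<in>UNIV. c \<alpha> i *s u i)" for \<alpha>
    unfolding vec_eq_iff h_def c_def matrix_vector_mult_def
    by (auto simp: sum_distrib_left sum_distrib_right ac_simps intro: sum.swap)
  have tr: "transpose h = h"
    by (simp add: h_def transpose_def vec_eq_iff mult.commute)
  have "h *v \<alpha> = 0 \<longleftrightarrow> (\<exists>d. \<alpha> = d *s \<theta>)" for \<alpha>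
  proof
    assume *: "h *v \<alpha> = 0"
    have c0: "c \<alpha> j = 0" for j
    proof (cases "j = k")
      case False
      \<comment> \<open>For \<open>j \<noteq> k\<close> only \<open>u j\<close> has a component
        along \<open>j\<close>, namely the pivot \<open>\<theta> $ k\<close>, so this component
        isolates \<open>c \<alpha> j\<close>.\<close>
      have "0 = (\<Sum>i\<in>UNIV. c \<alpha> i *s u i) $ j"
        using * h\<alpha> by simp
      also have "\<dots> = c \<alpha> j * \<theta> $ k"
        using False
        by (simp add: u_def axis_def algebra_simps sum_subtractf if_distrib[of "\<lambda>x. _ * x"] sum.If_cases cong: if_cong)
      finally show ?thesis using k by simp
    qed (simp add: c)
    have "\<alpha> $ j = \<alpha> $ k / \<theta> $ k * \<theta> $ j" for j
      using c0[of j] k unfolding c by (simp add: field_simps)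
    then have "\<alpha> = (\<alpha> $ k / \<theta> $ k) *s \<theta>"
      unfolding vec_eq_iff vector_smult_component by blast
    then show "\<exists>d. \<alpha> = d *s \<theta>"
      by blast
  next
    assume "\<exists>d. \<alpha> = d *s \<theta>"
    then have "c \<alpha> i = 0" for i
      by (auto simp: c)
    then show "h *v \<alpha> = 0"
      unfolding h\<alpha> by simp
  qed
  then have "{\<alpha>. h *v \<alpha> = 0} = {d *s \<theta> | d. True}"
    by auto
  then show ?thesis
    using that[OF tr] rank_two_kernel[OF tr assms] by simp
qed

section \<open>Inverse matrices\<close>

lemma matrix_inv_left_right:
  assumes "invertible A"
  shows "matrix_inv A ** A = mat 1" "A ** matrix_inv A = mat 1"
  using assms unfolding invertible_def matrix_inv_def by (metis (mono_tags, lifting) someI_ex)+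

lemma matrix_inv_eqI:
  assumes "A ** B = mat 1" "B ** A = mat 1"
  shows "matrix_inv A = B"
  by (metis assms invertible_def matrix_inv_left_right(1) matrix_mul_assoc matrix_mul_lid matrix_mul_rid)

text \<open>Cramer's rule. The explicit entries make the holomorphy of an inverse matrix checkable
  in \<open>holomorphic_matrix_inv\<close>.\<close>

lemma matrix_inv_2:
  fixes A :: "complex^2^2"
  assumes "invertible A"
  shows "matrix_inv A = vector [vector [A $ 2 $ 2 / det A, - A $ 1 $ 2 / det A],
                                vector [- A $ 2 $ 1 / det A, A $ 1 $ 1 / det A]]"
proof -
  have "det A \<noteq> 0"
    using assms invertible_det_nz by blast
  then have "A $ 1 $ 1 * A $ 2 $ 2 - A $ 1 $ 2 * A $ 2 $ 1 \<noteq> 0"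
    by (simp add: det_2)
  then show ?thesis
    by (intro matrix_inv_eqI)
      (simp_all add: vec_eq_iff forall_2 matrix_matrix_mult_def sum_2 mat_def det_2 divide_simps, (simp_all add: algebra_simps)?)
qed

lemma matrix_inv_mult:
  fixes A B :: "'a::semiring_1^'n^'n"
  assumes "invertible A" "invertible B"
  shows "matrix_inv (A ** B) = matrix_inv B ** matrix_inv A"
proof (rule matrix_inv_eqI)
  note A = matrix_inv_left_right[OF assms(1)] and B = matrix_inv_left_right[OF assms(2)]
  show "A ** B ** (matrix_inv B ** matrix_inv A) = mat 1"
    by (metis A(2) B(2) matrix_mul_assoc matrix_mul_rid)
  show "matrix_inv B ** matrix_inv A ** (A ** B) = mat 1"
    by (metis A(1) B(1) matrix_mul_assoc matrix_mul_rid)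
qed

lemma matrix_inv_vector:
  fixes A :: "'a::semiring_1^'n^'n"
  assumes "invertible A"
  shows "matrix_inv A *v (A *v u) = u" "A *v (matrix_inv A *v u) = u"
  using matrix_inv_left_right[OF assms] by (simp_all add: matrix_vector_mul_assoc)

lemma invertible_matrix_inv:
  assumes "invertible A"
  shows "invertible (matrix_inv A)" "matrix_inv (matrix_inv A) = A"
  using matrix_inv_left_right[OF assms] by (auto simp: invertible_def intro: matrix_inv_eqI)

subsection \<open>Entire functions of polynomial growth\<close>

text \<open>\<open>g\<close> is bounded on the closed unit disc, so outside it \<open>f\<close>
  grows at most like the \<open>k\<close>-th power of the modulus, and the polynomial form of
  Liouville's theorem applies.\<close>

lemma entire_polynomial_growth:
  assumes f: "f holomorphic_on UNIV" and g: "g holomorphic_on UNIV"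
    and fg: "\<And>l::complex. l \<noteq> 0 \<Longrightarrow> f l = l ^ k * g (1 / l)"
  shows "\<exists>a. \<forall>l. f l = (\<Sum>i\<le>k. a i * l ^ i)"
proof -
  have "continuous_on (cball 0 1) g"
    using g holomorphic_on_imp_continuous_on holomorphic_on_subset by blast
  then have "bounded (g ` cball 0 1)"
    using compact_continuous_image compact_imp_bounded compact_cball by blast
  then obtain B where B: "\<And>x. x \<in> cball 0 1 \<Longrightarrow> norm (g x) \<le> B"
    unfolding bounded_iff by blast
  have "norm (f z) \<le> B * norm z ^ k" if "1 \<le> norm z" for z
  proof -
    have "z \<noteq> 0" "1 / z \<in> cball 0 1"
      using that by (auto simp: norm_divide divide_simps)
    then show ?thesis
      using fg[of z] B[of "1 / z"] by (simp add: norm_mult norm_power mult.commute mult_right_mono)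
  qed
  then have "f l = (\<Sum>i\<le>k. (deriv ^^ i) f 0 / fact i * l ^ i)" for l
    by (rule Liouville_polynomial[OF f])
  then show ?thesis by (intro exI allI)
qed

lemma entire_constant:
  assumes "f holomorphic_on UNIV" "g holomorphic_on UNIV"
    and "\<And>l::complex. l \<noteq> 0 \<Longrightarrow> f l = g (1 / l)"
  shows "f l = f 0"
proof -
  from entire_polynomial_growth[OF assms(1,2), of 0] assms(3)
  obtain a where "\<forall>l. f l = (\<Sum>i\<le>0. a i * l ^ i)" by fastforce
  then show ?thesis by simp
qed

text \<open>This is the absence of nonzero sections of a line bundle of degree \<open>-k\<close>. By
  \<open>entire_constant\<close> the product \<open>l ^ k * f l\<close> is constant, and it vanishes
  at the origin because \<open>0 < k\<close>.\<close>

lemma entire_eq_zero: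
  assumes f: "f holomorphic_on UNIV" and g: "g holomorphic_on UNIV"
    and k: "0 < k" and fg: "\<And>l::complex. l \<noteq> 0 \<Longrightarrow> l ^ k * f l = g (1 / l)"
  shows "f l = 0"
proof -
  have hol: "(\<lambda>l. l ^ k * f l) holomorphic_on UNIV"
    using f by (intro holomorphic_intros)
  have *: "l ^ k * f l = 0" for l
    using entire_constant[OF hol g fg, of l] k by (simp add: power_0_left)
  have nz: "f l = 0" if "l \<noteq> 0" for l
    using *[of l] that by simp
  show ?thesis
  proof (cases "l = 0")
    case True
    \<comment> \<open>At the origin the factor \<open>l ^ k\<close> vanishes and gives no
      information on \<open>f\<close>; continuity supplies the value.\<close>
    have "isCont f 0"
      using f by (metis UNIV_I continuous_on_eq_continuous_at holomorphic_on_imp_continuous_on open_UNIV)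
    then have "f \<midarrow>0\<rightarrow> f 0"
      by (simp add: isCont_def)
    moreover have "f \<midarrow>0\<rightarrow> 0"
      using nz by (intro tendsto_eventually) (auto simp: eventually_at_filter)
    ultimately show ?thesis
      using True LIM_unique by blast
  qed (rule nz)
qed

subsection \<open>Partial derivatives and holomorphy\<close>

lemma linear_vecI:
  fixes \<phi> :: "'a::field^'n \<Rightarrow> 'a^'m"
  assumes "\<And>u v. \<phi> (u + v) = \<phi> u + \<phi> v" "\<And>c u. \<phi> (c *s u) = c *s \<phi> u"
  shows "Vector_Spaces.linear (*s) (*s) \<phi>"
  using assms by unfold_locales

lemma pd_linear:
  fixes \<phi> :: "complex^'n \<Rightarrow> complex^'m"
  assumes "Vector_Spaces.linear (*s) (*s) \<phi>"
  shows "pd a (\<lambda>y. \<phi> y $ \<mu>) x = \<phi> (axis a 1) $ \<mu>"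
proof -
  interpret Vector_Spaces.linear "(*s)" "(*s)" \<phi>
    by fact
  have "\<phi> (x + axis a t) $ \<mu> = \<phi> x $ \<mu> + t * \<phi> (axis a 1) $ \<mu>" for t
  proof -
    have "axis a t = t *s axis a (1::complex)"
      by (simp add: axis_def vec_eq_iff)
    then show ?thesis
      by (simp add: add scale)
  qed
  moreover have "((\<lambda>t. \<phi> x $ \<mu> + t * \<phi> (axis a 1) $ \<mu>) has_field_derivative \<phi> (axis a 1) $ \<mu>) (at 0)"
    by (auto intro!: derivative_eq_intros)
  ultimately show ?thesis
    unfolding pd_def by (simp add: DERIV_imp_deriv)
qed

lemma pd_const [simp]: "pd a (\<lambda>x. c) x = 0"
  by (simp add: pd_def)

lemma pd_pd_linear:
  fixes \<phi> :: "complex^'n \<Rightarrow> complex^'m"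
  assumes "Vector_Spaces.linear (*s) (*s) \<phi>"
  shows "pd b (pd c (\<lambda>y. \<phi> y $ \<mu>)) x = 0"
proof -
  have "pd c (\<lambda>y. \<phi> y $ \<mu>) = (\<lambda>x. \<phi> (axis c 1) $ \<mu>)"
    using pd_linear[OF assms] by blast
  then show ?thesis by simp
qed

lemma dw_linear:
  assumes "Vector_Spaces.linear (*s) (*s) (w l)"
  shows "dw w l x = matrix (w l)"
  unfolding dw_def matrix_def by (simp add: pd_linear[OF assms])

lemma normal_patching_linear:
  assumes "Vector_Spaces.linear (*s) (*s) (f l)"
  shows "normal_patching f w l x = matrix (f l)"
  unfolding normal_patching_def matrix_def by (simp add: pd_linear[OF assms])

lemma linear_Zfam: "Vector_Spaces.linear (*s) (*s) (Zfam \<epsilon> l)"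
  by (rule linear_vecI) (simp_all add: Zfam_def vec_eq_iff forall_2 field_simps add_divide_distrib)

lemma linear_Osum: "Vector_Spaces.linear (*s) (*s) (Osum n l)"
  by (rule linear_vecI) (simp_all add: Osum_def vec_eq_iff field_simps)

section \<open>Holomorphy on the moduli space and on its product with a chart\<close>

lemma holomorphic_M_const: "holomorphic_M (\<lambda>x. c)"
  unfolding holomorphic_M_def
  by (intro allI exI[of _ 0]) simp

lemma holomorphic_M_mult:
  assumes "holomorphic_M f" "holomorphic_M g"
  shows "holomorphic_M (\<lambda>x. f x * g x)"
  unfolding holomorphic_M_def
proof
  fix x
  obtain c where c: "(f has_derivative (\<lambda>h. \<Sum>a\<in>UNIV. c $ a * h $ a)) (at x)"
    using assms(1) unfolding holomorphic_M_def by blast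
  obtain d where d: "(g has_derivative (\<lambda>h. \<Sum>a\<in>UNIV. d $ a * h $ a)) (at x)"
    using assms(2) unfolding holomorphic_M_def by blast
  show "\<exists>e::complex^3. ((\<lambda>x. f x * g x) has_derivative (\<lambda>h. \<Sum>a\<in>UNIV. e $ a * h $ a)) (at x)"
    by (rule exI[of _ "f x *s d + g x *s c"], rule has_derivative_eq_rhs[OF has_derivative_mult[OF c d]])
      (simp add: fun_eq_iff sum_distrib_left sum_distrib_right sum.distrib algebra_simps)
qed

lemma holomorphic_M_inverse:
  assumes "holomorphic_M f" "\<And>x. f x \<noteq> 0"
  shows "holomorphic_M (\<lambda>x. inverse (f x))"
  unfolding holomorphic_M_def
proof
  fix x
  obtain c where c: "(f has_derivative (\<lambda>h. \<Sum>a\<in>UNIV. c $ a * h $ a)) (at x)"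
    using assms(1) unfolding holomorphic_M_def by blast
  show "\<exists>e::complex^3. ((\<lambda>x. inverse (f x)) has_derivative (\<lambda>h. \<Sum>a\<in>UNIV. e $ a * h $ a)) (at x)"
    by (rule exI[of _ "- (inverse (f x) * inverse (f x)) *s c"],
        rule has_derivative_eq_rhs[OF Deriv.has_derivative_inverse[OF assms(2) c]])
      (simp add: fun_eq_iff sum_distrib_left sum_distrib_right sum_negf algebra_simps)
qed

lemma holomorphic_UM_entire:
  assumes "\<phi> holomorphic_on UNIV"
  shows "holomorphic_UM (\<lambda>l x. \<phi> l)"
  unfolding holomorphic_UM_def
proof (intro allI)
  fix l and x :: "complex^3"
  have "(\<phi> has_field_derivative deriv \<phi> l) (at l)"
    using assms holomorphic_derivI open_UNIV by blast
  then have "(\<phi> has_derivative (*) (deriv \<phi> l)) (at (fst (l, x)))"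
    by (simp add: has_field_derivative_def)
  then have "((\<lambda>p. \<phi> (fst p)) has_derivative (\<lambda>p. deriv \<phi> l * fst p)) (at (l, x))"
    by (rule has_derivative_compose[OF has_derivative_fst[OF has_derivative_ident]])
  then show "\<exists>c0. \<exists>c::complex^3. ((\<lambda>(l, x). \<phi> l) has_derivative
      (\<lambda>(k, h). c0 * k + (\<Sum>a\<in>UNIV. c $ a * h $ a))) (at (l, x))"
    by (intro exI[of _ "deriv \<phi> l"] exI[of _ 0]) (simp add: case_prod_beta')
qed

lemma holomorphic_UM_mult:
  assumes "holomorphic_UM f" "holomorphic_UM g"
  shows "holomorphic_UM (\<lambda>l x. f l x * g l x)"
  unfolding holomorphic_UM_def
proof (intro allI)
  fix l and x :: "complex^3"
  obtain c0 and c :: "complex^3" where c: "((\<lambda>(l, x). f l x) has_derivative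
      (\<lambda>(k, h). c0 * k + (\<Sum>a\<in>UNIV. c $ a * h $ a))) (at (l, x))"
    using assms(1) unfolding holomorphic_UM_def by blast
  obtain d0 and d :: "complex^3" where d: "((\<lambda>(l, x). g l x) has_derivative
      (\<lambda>(k, h). d0 * k + (\<Sum>a\<in>UNIV. d $ a * h $ a))) (at (l, x))"
    using assms(2) unfolding holomorphic_UM_def by blast
  have "((\<lambda>(l, x). f l x * g l x) has_derivative
      (\<lambda>(k, h). (f l x * d0 + g l x * c0) * k + (\<Sum>a\<in>UNIV. (f l x *s d + g l x *s c) $ a * h $ a))) (at (l, x))"
    using has_derivative_mult[OF c d]
    by (rule has_derivative_eq_rhs[THEN back_subst[of "\<lambda>F. (F has_derivative _) _"]])
      (auto simp: fun_eq_iff sum_distrib_left sum_distrib_right sum.distrib algebra_simps)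
  then show "\<exists>e0. \<exists>e::complex^3. ((\<lambda>(l, x). f l x * g l x) has_derivative
      (\<lambda>(k, h). e0 * k + (\<Sum>a\<in>UNIV. e $ a * h $ a))) (at (l, x))"
    by blast
qed

lemma holomorphic_UM_add:
  assumes "holomorphic_UM f" "holomorphic_UM g"
  shows "holomorphic_UM (\<lambda>l x. f l x + g l x)"
  unfolding holomorphic_UM_def
proof (intro allI)
  fix l and x :: "complex^3"
  obtain c0 and c :: "complex^3" where c: "((\<lambda>(l, x). f l x) has_derivative
      (\<lambda>(k, h). c0 * k + (\<Sum>a\<in>UNIV. c $ a * h $ a))) (at (l, x))"
    using assms(1) unfolding holomorphic_UM_def by blast
  obtain d0 and d :: "complex^3" where d: "((\<lambda>(l, x). g l x) has_derivative
      (\<lambda>(k, h). d0 * k + (\<Sum>a\<in>UNIV. d $ a * h $ a))) (at (l, x))"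
    using assms(2) unfolding holomorphic_UM_def by blast
  have "((\<lambda>(l, x). f l x + g l x) has_derivative
      (\<lambda>(k, h). (c0 + d0) * k + (\<Sum>a\<in>UNIV. (c + d) $ a * h $ a))) (at (l, x))"
    using has_derivative_add[OF c d]
    by (rule has_derivative_eq_rhs[THEN back_subst[of "\<lambda>F. (F has_derivative _) _"]])
      (auto simp: fun_eq_iff sum.distrib algebra_simps)
  then show "\<exists>e0. \<exists>e::complex^3. ((\<lambda>(l, x). f l x + g l x) has_derivative
      (\<lambda>(k, h). e0 * k + (\<Sum>a\<in>UNIV. e $ a * h $ a))) (at (l, x))"
    by blast
qed

lemma holomorphic_UM_const: "holomorphic_UM (\<lambda>l x. c)"
  by (rule holomorphic_UM_entire) simp

lemma holomorphic_UM_sum: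
  assumes "finite A" "\<And>i. i \<in> A \<Longrightarrow> holomorphic_UM (f i)"
  shows "holomorphic_UM (\<lambda>l x. \<Sum>i\<in>A. f i l x)"
  using assms by (induction A rule: finite_induct) (simp_all add: holomorphic_UM_const holomorphic_UM_add)

text \<open>The slice at a fixed \<open>x\<close> lets the results on entire functions act on the
  entries of a splitting matrix one section at a time.\<close>

lemma holomorphic_UM_fibre:
  assumes "holomorphic_UM f"
  shows "(\<lambda>l. f l x) holomorphic_on UNIV"
proof -
  have "(\<lambda>l. f l x) field_differentiable at l" for l
  proof -
    obtain c0 and c :: "complex^3" where c: "((\<lambda>(l, x). f l x) has_derivative
        (\<lambda>(k, h). c0 * k + (\<Sum>a\<in>UNIV. c $ a * h $ a))) (at (l, x))"
      using assms unfolding holomorphic_UM_def by blast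
    have "((\<lambda>l. (l, x)) has_derivative (\<lambda>k. (k, 0))) (at l)"
      by (auto intro!: derivative_eq_intros)
    from has_derivative_compose[OF this c]
    have "((\<lambda>l. f l x) has_field_derivative c0) (at l)"
      by (simp add: has_field_derivative_def)
    then show ?thesis
      using field_differentiable_def by blast
  qed
  then show ?thesis
    by (simp add: holomorphic_on_def)
qed

text \<open>The complementary slice at a fixed \<open>l\<close>; it makes the conformal factor in
  \<open>minitwistor_frame\<close> holomorphic on the moduli space.\<close>

lemma holomorphic_UM_base:
  assumes "holomorphic_UM f"
  shows "holomorphic_M (f l)"
  unfolding holomorphic_M_def
proof
  fix x
  obtain c0 and c :: "complex^3" where c: "((\<lambda>(l, x). f l x) has_derivative
      (\<lambda>(k, h). c0 * k + (\<Sum>a\<in>UNIV. c $ a * h $ a))) (at (l, x))"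
    using assms unfolding holomorphic_UM_def by blast
  have "((\<lambda>x. (l, x)) has_derivative (\<lambda>h. (0, h))) (at x)"
    by (auto intro!: derivative_eq_intros)
  from has_derivative_compose[OF this c]
  show "\<exists>c::complex^3. (f l has_derivative (\<lambda>h. \<Sum>a\<in>UNIV. c $ a * h $ a)) (at x)"
    by (intro exI[of _ c]) simp
qed

lemma holomorphic_matrix_inv:
  fixes P :: "complex \<Rightarrow> complex^2^2"
  assumes hol: "\<And>i j. (\<lambda>l. P l $ i $ j) holomorphic_on UNIV" and inv: "\<And>l. invertible (P l)"
  shows "(\<lambda>l. matrix_inv (P l) $ i $ j) holomorphic_on UNIV"
proof -
  have nz: "P l $ 1 $ 1 * P l $ 2 $ 2 - P l $ 1 $ 2 * P l $ 2 $ 1 \<noteq> 0" for l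
    using inv[of l] invertible_det_nz[of "P l"] by (simp add: det_2)
  have "\<forall>i j. (\<lambda>l. matrix_inv (P l) $ i $ j) holomorphic_on UNIV"
    unfolding matrix_inv_2[OF inv] forall_2 det_2
    by (simp, intro conjI holomorphic_intros hol nz)
  then show ?thesis by blast
qed

lemma holomorphic_matrix_vector:
  fixes P :: "complex \<Rightarrow> complex^'n^'m"
  assumes "\<And>i j. (\<lambda>l. P l $ i $ j) holomorphic_on UNIV" "\<And>i. (\<lambda>l. s l $ i) holomorphic_on UNIV"
  shows "(\<lambda>l. (P l *v s l) $ i) holomorphic_on UNIV"
  unfolding matrix_vector_mult_def vec_lambda_beta
  by (intro holomorphic_intros assms)

subsection \<open>Covariance under bundle isomorphisms\<close>

lemma bundle_iso_sym:
  assumes "bundle_iso f g P Ph"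
  shows "bundle_iso g f (\<lambda>l. matrix_inv (P l)) (\<lambda>k. matrix_inv (Ph k))"
proof -
  have inv: "invertible (P l)" "invertible (Ph l)" for l
    using assms by (auto simp: bundle_iso_def)
  have "matrix_inv (Ph (1 / l)) *v g l u = f l (matrix_inv (P l) *v u)" if "l \<noteq> 0" for l u
  proof -
    have "Ph (1 / l) *v f l (matrix_inv (P l) *v u) = g l u"
      using assms that by (simp add: bundle_iso_def matrix_inv_vector[OF inv(1)])
    then show ?thesis
      by (metis matrix_inv_vector(1)[OF inv(2)])
  qed
  then show ?thesis
    using assms by (simp add: bundle_iso_def holomorphic_matrix_inv invertible_matrix_inv)
qed

lemma bundle_iso_global_section:
  assumes "bundle_iso f g P Ph" "s \<in> global_sections f"
  shows "(\<lambda>l. P l *v s l) \<in> global_sections g"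
proof -
  obtain sh where sh: "\<And>i. (\<lambda>k. sh k $ i) holomorphic_on UNIV" "\<And>l. l \<noteq> 0 \<Longrightarrow> sh (1 / l) = f l (s l)"
    and s: "\<And>i. (\<lambda>l. s l $ i) holomorphic_on UNIV"
    using assms(2) unfolding global_sections_def by blast
  show ?thesis
    unfolding global_sections_def mem_Collect_eq
    using assms(1) s sh
    by (intro conjI exI[of _ "\<lambda>k. Ph k *v sh k"] allI holomorphic_matrix_vector)
      (auto simp: bundle_iso_def)
qed

lemma bundle_iso_inverse:
  assumes "bundle_iso f g P Ph"
  shows "matrix_inv (P l) *v (P l *v u) = u" "P l *v (matrix_inv (P l) *v u) = u"
  using assms by (simp_all add: bundle_iso_def matrix_inv_vector)

lemma bij_betw_global_sections:
  assumes "bundle_iso f g P Ph"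
  shows "bij_betw (\<lambda>s l. P l *v s l) (global_sections f) (global_sections g)"
  using bundle_iso_global_section[OF assms] bundle_iso_global_section[OF bundle_iso_sym[OF assms]]
  by (intro bij_betw_byWitness[where f' = "\<lambda>s l. matrix_inv (P l) *v s l"])
    (auto simp: bundle_iso_inverse[OF assms])

lemma linear_matrix_vector_compose:
  fixes A :: "'a::field^'n^'m"
  assumes "Vector_Spaces.linear (*s) (*s) \<phi>"
  shows "Vector_Spaces.linear (*s) (*s) (\<lambda>x. A *v \<phi> x)"
  using Vector_Spaces.linear_compose[OF assms matrix_vector_mul_linear_gen[of A]] by (simp add: o_def)

lemma matrix_matrix_vector_compose:
  fixes A :: "'a::field^'n^'m"
  assumes "Vector_Spaces.linear (*s) (*s) \<phi>"
  shows "matrix (\<lambda>x. A *v \<phi> x) = A ** matrix \<phi>"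
  using matrix_compose_gen[OF assms matrix_vector_mul_linear_gen[of A]] by (simp add: o_def)

lemma bundle_iso_linear_coordinates:
  assumes "bundle_iso f g P Ph" "linear_coordinates f w"
  shows "linear_coordinates g (\<lambda>l x. P l *v w l x)"
  using bij_betw_trans[of "\<lambda>x l. w l x", OF _ bij_betw_global_sections[OF assms(1)]] assms(2)
  by (auto simp: linear_coordinates_def o_def intro: linear_matrix_vector_compose)

text \<open>Reading the coefficients of \<open>\<sigma>\<close> at a point as a bilinear map on the
  fibre turns the index equations for splittings and connections into coordinate-free ones.\<close>

definition bilin :: "(2 \<Rightarrow> 2 \<Rightarrow> 2 \<Rightarrow> complex) \<Rightarrow> complex^2 \<Rightarrow> complex^2 \<Rightarrow> complex^2" where
  "bilin s u v = (\<chi> \<mu>. \<Sum>\<nu>\<in>UNIV. \<Sum>\<rho>\<in>UNIV. s \<mu> \<nu> \<rho> * u $ \<nu> * v $ \<rho>)"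

text \<open>The components of the pushforward of a bilinear map along \<open>A\<close>, which sends
  \<open>u\<close>, \<open>v\<close> to \<open>A s(A^-1 u, A^-1 v)\<close>. As the change of fibre
  coordinates is linear, no inhomogeneous term appears.\<close>

definition transport ::
  "complex^2^2 \<Rightarrow> (2 \<Rightarrow> 2 \<Rightarrow> 2 \<Rightarrow> complex) \<Rightarrow> 2 \<Rightarrow> 2 \<Rightarrow> 2 \<Rightarrow> complex" where
  "transport A s \<mu> \<nu> \<rho> = (A *v bilin s (column \<nu> (matrix_inv A)) (column \<rho> (matrix_inv A))) $ \<mu>"

lemma bilin_matrix_vector:
  fixes F :: "complex^2^2"
  shows "bilin t (F *v u) (F *v v) =
     (\<Sum>\<alpha>\<in>UNIV. \<Sum>\<beta>\<in>UNIV. (u $ \<alpha> * v $ \<beta>) *s bilin t (column \<alpha> F) (column \<beta> F))"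
  by (simp add: bilin_def vec_eq_iff sum_2 matrix_vector_mult_def forall_2 column_def algebra_simps)

lemma bilin_transport:
  "bilin (transport A s) u v = A *v bilin s (matrix_inv A *v u) (matrix_inv A *v v)"
proof -
  define b where "b \<nu> \<rho> = bilin s (column \<nu> (matrix_inv A)) (column \<rho> (matrix_inv A))" for \<nu> \<rho>
  show ?thesis
    unfolding bilin_matrix_vector bilin_def[of "transport A s"] transport_def b_def[symmetric]
    by (simp add: vec_eq_iff sum_2 matrix_vector_mult_def algebra_simps)
qed

lemma bilin_columns:
  assumes "\<And>\<alpha> \<beta>. bilin t (column \<alpha> F) (column \<beta> F) = F *v (\<chi> \<eta>. s \<eta> \<alpha> \<beta>)"
  shows "bilin t (F *v u) (F *v v) = F *v bilin s u v"
  unfolding bilin_matrix_vector assms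
  by (simp add: bilin_def vec_eq_iff sum_2 matrix_vector_mult_def forall_2 algebra_simps)

lemma bilin_axis: "bilin s (axis \<alpha> 1) (axis \<beta> 1) = (\<chi> \<eta>. s \<eta> \<alpha> \<beta>)"
  by (simp add: bilin_def vec_eq_iff axis_def if_distrib[of "\<lambda>x. _ * x"] cong: if_cong)

text \<open>The second derivatives of a fibrewise linear patching vanish, so the splitting equation
  becomes homogeneous: the patching matrix intertwines \<open>\<sigma>\<close> with
  \<open>\<sigma>h\<close>.\<close>

lemma sigma_splitting_linear:
  assumes f: "\<And>l. Vector_Spaces.linear (*s) (*s) (f l)"
  shows "sigma_splitting f w \<sigma> \<sigma>h \<longleftrightarrow>
     (\<forall>\<mu> \<nu> \<rho>. holomorphic_UM (\<lambda>l x. \<sigma> l x \<mu> \<nu> \<rho>) \<and> holomorphic_UM (\<lambda>l x. \<sigma>h l x \<mu> \<nu> \<rho>)) \<and>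
     (\<forall>l x \<mu> \<nu> \<rho>. \<sigma> l x \<mu> \<nu> \<rho> = \<sigma> l x \<mu> \<rho> \<nu> \<and> \<sigma>h l x \<mu> \<nu> \<rho> = \<sigma>h l x \<mu> \<rho> \<nu>) \<and>
     (\<forall>l x u v. l \<noteq> 0 \<longrightarrow>
        bilin (\<sigma>h (1 / l) x) (matrix (f l) *v u) (matrix (f l) *v v) = matrix (f l) *v bilin (\<sigma> l x) u v)"
    (is "_ \<longleftrightarrow> ?A \<and> ?B \<and> ?C")
proof -
  define F where "F l = matrix (f l)" for l
  have pt: "(\<forall>\<mu> \<alpha> \<beta>. 0 = - (\<Sum>\<nu>\<in>UNIV. \<Sum>\<rho>\<in>UNIV. t \<mu> \<nu> \<rho> * A $ \<nu> $ \<alpha> * A $ \<rho> $ \<beta>)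
            + (\<Sum>\<eta>\<in>UNIV. A $ \<mu> $ \<eta> * s \<eta> \<alpha> \<beta>)) \<longleftrightarrow>
        (\<forall>u v. bilin t (A *v u) (A *v v) = A *v bilin s u v)" for t s and A :: "complex^2^2"
  proof -
    have "(\<forall>\<mu> \<alpha> \<beta>. 0 = - (\<Sum>\<nu>\<in>UNIV. \<Sum>\<rho>\<in>UNIV. t \<mu> \<nu> \<rho> * A $ \<nu> $ \<alpha> * A $ \<rho> $ \<beta>)
            + (\<Sum>\<eta>\<in>UNIV. A $ \<mu> $ \<eta> * s \<eta> \<alpha> \<beta>)) \<longleftrightarrow>
          (\<forall>\<alpha> \<beta>. bilin t (column \<alpha> A) (column \<beta> A) = A *v (\<chi> \<eta>. s \<eta> \<alpha> \<beta>))"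
      unfolding vec_eq_iff by (auto simp: bilin_def column_def matrix_vector_mult_def)
    \<comment> \<open>Bilinearity extends the identity from basis vectors to all vectors; conversely
      one evaluates at basis vectors, which a matrix sends to its columns.\<close>
    also have "\<dots> \<longleftrightarrow> (\<forall>u v. bilin t (A *v u) (A *v v) = A *v bilin s u v)"
      using bilin_columns[of t A s] by (metis bilin_axis matrix_vector_mult_axis)
    finally show ?thesis .
  qed
  have "sigma_splitting f w \<sigma> \<sigma>h \<longleftrightarrow> ?A \<and> ?B \<and>
     (\<forall>l x. l \<noteq> 0 \<longrightarrow> (\<forall>\<mu> \<alpha> \<beta>. 0 = - (\<Sum>\<nu>\<in>UNIV. \<Sum>\<rho>\<in>UNIV. \<sigma>h (1 / l) x \<mu> \<nu> \<rho> * F l $ \<nu> $ \<alpha> * F l $ \<rho> $ \<beta>)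
            + (\<Sum>\<eta>\<in>UNIV. F l $ \<mu> $ \<eta> * \<sigma> l x \<eta> \<alpha> \<beta>)))"
    unfolding sigma_splitting_def normal_patching_linear[OF f] pd_pd_linear[OF f] F_def by blast
  then show ?thesis
    unfolding pt F_def by blast
qed

text \<open>In linear coordinates \<open>dw\<close> is the constant matrix of \<open>w l\<close> and
  the second derivatives of \<open>w\<close> vanish, so only the \<open>\<sigma>\<close> term
  remains on the right.\<close>

lemma Lambda_connection_linear:
  assumes w: "\<And>l. Vector_Spaces.linear (*s) (*s) (w l)"
  shows "Lambda_connection f w \<Gamma> \<longleftrightarrow> torsion_free \<Gamma> \<and>
     (\<exists>\<sigma> \<sigma>h. sigma_splitting f w \<sigma> \<sigma>h \<and>
        (\<forall>l x b c. w l (\<chi> a. \<Gamma> x a b c) = bilin (\<sigma> l x) (w l (axis b 1)) (w l (axis c 1))))"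
proof -
  have *: "matrix (w l) *v u = w l u" "matrix (w l) $ i $ j = w l (axis j 1) $ i" for l u i j
    by (simp_all add: w matrix_works) (simp add: matrix_def)
  have "w l (\<chi> a. \<Gamma> x a b c) = bilin (\<sigma> l x) (w l (axis b 1)) (w l (axis c 1)) \<longleftrightarrow>
        (\<forall>\<mu>. (\<Sum>a\<in>UNIV. \<Gamma> x a b c * dw w l x $ \<mu> $ a) =
             pd b (pd c (\<lambda>y. w l y $ \<mu>)) x
             + (\<Sum>\<nu>\<in>UNIV. \<Sum>\<rho>\<in>UNIV. \<sigma> l x \<mu> \<nu> \<rho> * dw w l x $ \<nu> $ b * dw w l x $ \<rho> $ c))"
    for l x b c \<sigma>
    unfolding pd_pd_linear[OF w] dw_linear[OF w] *(1)[symmetric, of _ "\<chi> a. \<Gamma> x a b c"] vec_eq_iff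
    by (simp add: bilin_def matrix_vector_mult_def *(2) mult.commute)
  then show ?thesis
    unfolding Lambda_connection_def by (meson)
qed

lemma holomorphic_UM_matrix_mult:
  assumes "\<And>i j. (\<lambda>l. P l $ i $ j) holomorphic_on UNIV" "\<And>i j. holomorphic_UM (\<lambda>l x. H l x $ i $ j)"
  shows "holomorphic_UM (\<lambda>l x. (P l ** H l x) $ i $ j)"
  unfolding matrix_matrix_mult_def vec_lambda_beta
  by (intro holomorphic_UM_sum holomorphic_UM_mult holomorphic_UM_entire assms finite)

lemma holomorphic_UM_transport:
  assumes P: "\<And>i j. (\<lambda>l. P l $ i $ j) holomorphic_on UNIV" and inv: "\<And>l. invertible (P l)"
    and \<sigma>: "\<And>\<mu> \<nu> \<rho>. holomorphic_UM (\<lambda>l x. \<sigma> l x \<mu> \<nu> \<rho>)"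
  shows "holomorphic_UM (\<lambda>l x. transport (P l) (\<sigma> l x) \<mu> \<nu> \<rho>)"
  unfolding transport_def bilin_def matrix_vector_mult_def column_def vec_lambda_beta
  by (intro holomorphic_UM_sum holomorphic_UM_mult finite P[THEN holomorphic_UM_entire] \<sigma>
      holomorphic_matrix_inv[OF P inv, THEN holomorphic_UM_entire])

section \<open>Transport of splittings, frames and connections along an isomorphism\<close>

context
  fixes f g :: patching and P Ph :: "complex \<Rightarrow> complex^2^2" and w :: "complex \<Rightarrow> complex^3 \<Rightarrow> complex^2"
  assumes f: "\<And>l. Vector_Spaces.linear (*s) (*s) (f l)"
    and g: "\<And>l. Vector_Spaces.linear (*s) (*s) (g l)"
    and w: "\<And>l. Vector_Spaces.linear (*s) (*s) (w l)"
    and iso: "bundle_iso f g P Ph"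
begin

lemma bundle_iso_inv: "invertible (P l)" "invertible (Ph l)"
  using iso by (simp_all add: bundle_iso_def)

lemma bundle_iso_matrix:
  assumes "l \<noteq> 0"
  shows "Ph (1 / l) ** matrix (f l) = matrix (g l) ** P l"
proof -
  have "Ph (1 / l) *v f l u = g l (P l *v u)" for u
    using iso assms by (simp add: bundle_iso_def)
  then show ?thesis
    by (simp add: matrix_eq matrix_vector_mul_assoc[symmetric] matrix_works f g)
qed

text \<open>The new patching matrix is
  \<open>Ph (1 / l) ** matrix (f l) ** matrix_inv (P l)\<close>, so the outer factors are absorbed
  into \<open>Hh\<close> and \<open>H\<close> and the diagonal is unchanged.\<close>

lemma bundle_iso_normal_splitting:
  assumes "normal_splitting f w n H Hh"
  shows "normal_splitting g (\<lambda>l x. P l *v w l x) n (\<lambda>l x. P l ** H l x) (\<lambda>k x. Ph k ** Hh k x)"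
proof -
  have H: "invertible (H l x)" for l x
    using assms by (simp add: normal_splitting_def)
  let ?D = "\<lambda>l. (\<chi> i j. if i = j then l powi (- (n $ i)) else 0) :: complex^2^2"
  have "matrix (g l) = Ph (1 / l) ** Hh (1 / l) x ** ?D l ** matrix_inv (P l ** H l x)" if "l \<noteq> 0" for l x
  proof -
    have "matrix (g l) = matrix (g l) ** P l ** matrix_inv (P l)"
      by (metis matrix_inv_left_right(2)[OF bundle_iso_inv(1)] matrix_mul_assoc matrix_mul_rid)
    also have "\<dots> = Ph (1 / l) ** matrix (f l) ** matrix_inv (P l)"
      using bundle_iso_matrix[OF that] by simp
    also have "matrix (f l) = Hh (1 / l) x ** ?D l ** matrix_inv (H l x)"
      using assms that by (simp add: normal_splitting_def normal_patching_linear[OF f])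
    finally show ?thesis
      by (simp add: matrix_inv_mult[OF bundle_iso_inv(1) H] matrix_mul_assoc)
  qed
  then show ?thesis
    using assms iso unfolding normal_splitting_def normal_patching_linear[OF g]
    by (simp add: bundle_iso_def holomorphic_UM_matrix_mult invertible_mult)
qed

text \<open>Both \<open>H\<close> and \<open>dw\<close> acquire \<open>P\<close> on the left, which
  cancels in the product of the inverse of \<open>H\<close> with \<open>dw\<close>.\<close>

lemma bundle_iso_frame_section:
  assumes "invertible (H l x)"
  shows "frame_section (\<lambda>l x. P l *v w l x) (\<lambda>l x. P l ** H l x) l x = frame_section w H l x"
proof -
  have "matrix_inv (H l x) ** matrix_inv (P l) ** (P l ** matrix (w l)) = matrix_inv (H l x) ** matrix (w l)"
    by (metis matrix_inv_left_right(1)[OF bundle_iso_inv(1)] matrix_mul_assoc matrix_mul_rid)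
  then show ?thesis
    unfolding frame_section_def
    by (simp add: dw_linear w linear_matrix_vector_compose matrix_matrix_vector_compose
        matrix_inv_mult[OF bundle_iso_inv(1) assms])
qed

lemma bundle_iso_Lambda_connection:
  assumes "Lambda_connection f w \<Gamma>"
  shows "Lambda_connection g (\<lambda>l x. P l *v w l x) \<Gamma>"
proof -
  obtain \<sigma> \<sigma>h where tf: "torsion_free \<Gamma>" and s: "sigma_splitting f w \<sigma> \<sigma>h"
    and \<Gamma>: "\<And>l x b c. w l (\<chi> a. \<Gamma> x a b c) = bilin (\<sigma> l x) (w l (axis b 1)) (w l (axis c 1))"
    using assms unfolding Lambda_connection_linear[OF w] by blast
  have eq: "bilin (\<sigma>h (1 / l) x) (matrix (f l) *v u) (matrix (f l) *v v) = matrix (f l) *v bilin (\<sigma> l x) u v"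
    if "l \<noteq> 0" for l x u v
    using s that unfolding sigma_splitting_linear[OF f] by blast
  \<comment> \<open>The same \<open>\<Gamma>\<close> serves for the new coordinates: pushing
    \<open>\<sigma>\<close> forward by \<open>P\<close> multiplies both sides of its defining
    equation by \<open>P\<close>.\<close>
  define \<tau> \<tau>h where "\<tau> l x = transport (P l) (\<sigma> l x)" and "\<tau>h k x = transport (Ph k) (\<sigma>h k x)" for l k x
  \<comment> \<open>The compatibility of \<open>P\<close> and \<open>Ph\<close> with the patchings,
    written in the form in which it enters the arguments of the transported bilinear maps.\<close>
  have gm: "matrix_inv (Ph (1 / l)) *v (matrix (g l) *v u) = matrix (f l) *v (matrix_inv (P l) *v u)"
    if "l \<noteq> 0" for l u
  proof -
    have "matrix (g l) *v u = Ph (1 / l) *v (matrix (f l) *v (matrix_inv (P l) *v u))"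
      using bundle_iso_matrix[OF that]
      by (metis bundle_iso_inverse(2)[OF iso] matrix_vector_mul_assoc)
    then show ?thesis
      by (metis matrix_inv_vector(1)[OF bundle_iso_inv(2)])
  qed
  have "bilin (\<tau>h (1 / l) x) (matrix (g l) *v u) (matrix (g l) *v v) = matrix (g l) *v bilin (\<tau> l x) u v"
    if "l \<noteq> 0" for l x u v
    unfolding \<tau>_def \<tau>h_def bilin_transport gm[OF that] eq[OF that]
    by (metis bundle_iso_matrix[OF that] matrix_vector_mul_assoc)
  moreover have "holomorphic_UM (\<lambda>l x. \<tau> l x \<mu> \<nu> \<rho>) \<and> holomorphic_UM (\<lambda>l x. \<tau>h l x \<mu> \<nu> \<rho>)" for \<mu> \<nu> \<rho>
    using s iso unfolding \<tau>_def \<tau>h_def sigma_splitting_def bundle_iso_def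
    by (intro conjI holomorphic_UM_transport) auto
  moreover have "\<tau> l x \<mu> \<nu> \<rho> = \<tau> l x \<mu> \<rho> \<nu> \<and> \<tau>h l x \<mu> \<nu> \<rho> = \<tau>h l x \<mu> \<rho> \<nu>" for l x \<mu> \<nu> \<rho>
  proof -
    have sym: "bilin t u v = bilin t v u" if "\<And>\<mu> \<nu> \<rho>. t \<mu> \<nu> \<rho> = t \<mu> \<rho> \<nu>" for t u v
      using that[of _ 1 2] by (simp add: bilin_def vec_eq_iff sum_2 algebra_simps)
    have "\<sigma> l x \<mu> \<nu> \<rho> = \<sigma> l x \<mu> \<rho> \<nu>" "\<sigma>h l x \<mu> \<nu> \<rho> = \<sigma>h l x \<mu> \<rho> \<nu>" for l x \<mu> \<nu> \<rho>
      using s unfolding sigma_splitting_def by blast+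
    then show ?thesis
      unfolding \<tau>_def \<tau>h_def transport_def by (metis sym)
  qed
  ultimately have "sigma_splitting g (\<lambda>l x. P l *v w l x) \<tau> \<tau>h"
    unfolding sigma_splitting_linear[OF g] by blast
  moreover have "P l *v w l (\<chi> a. \<Gamma> x a b c) = bilin (\<tau> l x) (P l *v w l (axis b 1)) (P l *v w l (axis c 1))"
    for l x b c
    by (simp add: \<tau>_def bilin_transport \<Gamma> bundle_iso_inverse[OF iso])
  ultimately show ?thesis
    unfolding Lambda_connection_linear[OF linear_matrix_vector_compose[OF w]] using tf by blast
qed

text \<open>The triple itself is kept; only the witnesses \<open>H\<close>, \<open>Hh\<close>,
  \<open>\<sigma>\<close>, \<open>\<sigma>h\<close> change, and the other conditions do not mention
  the bundle. The reverse inclusion comes from the inverse isomorphism.\<close>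

lemma induced_structures_subset:
  "induced_structures f w \<subseteq> induced_structures g (\<lambda>l x. P l *v w l x)"
proof
  fix t assume t: "t \<in> induced_structures f w"
  obtain h \<theta> \<Gamma> where [simp]: "t = (h, \<theta>, \<Gamma>)"
    by (cases t)
  obtain H Hh where H: "normal_splitting f w (vector [0, 1]) H Hh" "\<And>l x. frame_section w H l x $ 1 = \<theta> x"
    using t by (auto simp: induced_structures_def)
  then have "frame_section (\<lambda>l x. P l *v w l x) (\<lambda>l x. P l ** H l x) l x $ 1 = \<theta> x" for l x
    by (simp add: bundle_iso_frame_section normal_splitting_def)
  with bundle_iso_normal_splitting[OF H(1)]
  have "\<exists>H Hh. normal_splitting g (\<lambda>l x. P l *v w l x) (vector [0, 1]) H Hh \<and>
      (\<forall>l x. frame_section (\<lambda>l x. P l *v w l x) H l x $ 1 = \<theta> x)"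
    by blast
  with t show "t \<in> induced_structures g (\<lambda>l x. P l *v w l x)"
    by (simp add: induced_structures_def bundle_iso_Lambda_connection)
qed

end

lemma induced_structures_bundle_iso:
  assumes "\<And>l. Vector_Spaces.linear (*s) (*s) (f l)" "\<And>l. Vector_Spaces.linear (*s) (*s) (g l)"
    and "\<And>l. Vector_Spaces.linear (*s) (*s) (w l)" and iso: "bundle_iso f g P Ph"
  shows "induced_structures f w = induced_structures g (\<lambda>l x. P l *v w l x)"
proof
  show "induced_structures f w \<subseteq> induced_structures g (\<lambda>l x. P l *v w l x)"
    by (rule induced_structures_subset) fact+
  have "induced_structures g (\<lambda>l x. P l *v w l x)
      \<subseteq> induced_structures f (\<lambda>l x. matrix_inv (P l) *v (P l *v w l x))"
    by (rule induced_structures_subset)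
      (use assms in \<open>auto intro: linear_matrix_vector_compose bundle_iso_sym\<close>)
  then show "induced_structures g (\<lambda>l x. P l *v w l x) \<subseteq> induced_structures f w"
    by (simp add: bundle_iso_inverse[OF iso])
qed

subsection \<open>Sums of line bundles\<close>

lemma Osum_section_polynomial:
  assumes s: "s \<in> global_sections (Osum n)" and n: "n $ i = int k"
  shows "\<exists>a. \<forall>l. s l $ i = (\<Sum>j\<le>k. a j * l ^ j)"
proof -
  obtain sh where sh: "(\<lambda>k. sh k $ i) holomorphic_on UNIV" "\<And>l. l \<noteq> 0 \<Longrightarrow> sh (1 / l) = Osum n l (s l)"
    and hol: "(\<lambda>l. s l $ i) holomorphic_on UNIV"
    using s unfolding global_sections_def by blast
  have "s l $ i = l ^ k * sh (1 / l) $ i" if "l \<noteq> 0" for l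
    using that by (simp add: sh(2) Osum_def n power_int_minus)
  then show ?thesis
    by (rule entire_polynomial_growth[OF hol sh(1)])
qed

lemma Osum_section_eq_0:
  assumes s: "s \<in> global_sections (Osum n)" and n: "n $ i < 0"
  shows "s l $ i = 0"
proof -
  obtain sh where sh: "(\<lambda>k. sh k $ i) holomorphic_on UNIV" "\<And>l. l \<noteq> 0 \<Longrightarrow> sh (1 / l) = Osum n l (s l)"
    and hol: "(\<lambda>l. s l $ i) holomorphic_on UNIV"
    using s unfolding global_sections_def by blast
  have *: "l ^ nat (- n $ i) * s l $ i = sh (1 / l) $ i" if "l \<noteq> 0" for l
    using that n by (simp add: sh(2) Osum_def power_int_def)
  show ?thesis
    using n by (intro entire_eq_zero[OF hol sh(1) _ *]) auto
qed

lemma matrix_Osum: "matrix (Osum n l) = (\<chi> i j. if i = j then l powi (- (n $ i)) else 0)"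
  by (simp add: matrix_def Osum_def vec_eq_iff axis_def)

lemma normal_splitting_Osum: "normal_splitting (Osum n) w n (\<lambda>l x. mat 1) (\<lambda>l x. mat 1)"
proof -
  have "invertible (mat 1 :: complex^2^2)" "matrix_inv (mat 1 :: complex^2^2) = mat 1"
    by (auto simp: invertible_def intro: matrix_inv_eqI)
  then show ?thesis
    by (simp add: normal_splitting_def normal_patching_linear linear_Osum matrix_Osum holomorphic_UM_const)
qed

text \<open>Entries of \<open>D ** H = Hh ** D\<close> for the diagonal patching \<open>D\<close>.
  Thus entry \<open>i\<close>, \<open>j\<close> of \<open>H\<close> is a global section of the line
  bundle of degree \<open>n $ i - n $ j\<close>, which is how its dependence on \<open>l\<close>
  gets controlled.\<close>

lemma normal_splitting_Osum_entries:
  assumes "normal_splitting (Osum n) w n H Hh" and l: "l \<noteq> 0"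
  shows "l powi (- (n $ i)) * H l x $ i $ j = Hh (1 / l) x $ i $ j * l powi (- (n $ j))"
proof -
  let ?D = "(\<chi> i j. if i = j then l powi (- (n $ i)) else 0) :: complex^2^2"
  have inv: "invertible (H l x)" and D: "?D = Hh (1 / l) x ** ?D ** matrix_inv (H l x)"
    using assms by (auto simp: normal_splitting_def normal_patching_linear linear_Osum matrix_Osum)
  have "?D ** H l x = Hh (1 / l) x ** ?D"
    using arg_cong[OF D, of "\<lambda>M. M ** H l x"]
    by (simp only: matrix_mul_assoc[symmetric] matrix_inv_left_right(1)[OF inv] matrix_mul_rid)
  then have "(?D ** H l x) $ i $ j = (Hh (1 / l) x ** ?D) $ i $ j"
    by simp
  then show ?thesis
    by (simp add: matrix_matrix_mult_def if_distrib[of "\<lambda>x. _ * x"] if_distrib[of "\<lambda>x. x * _"] cong: if_cong)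
qed

lemma frame_section_mult:
  assumes "normal_splitting f w n H Hh"
  shows "H l x ** frame_section w H l x = dw w l x"
proof -
  have "invertible (H l x)"
    using assms by (simp add: normal_splitting_def)
  then show ?thesis
    by (metis frame_section_def matrix_inv_left_right(2) matrix_mul_assoc matrix_mul_lid)
qed

subsection \<open>The minitwistor conformal structure\<close>

lemma bundle_iso_id:
  assumes "\<And>l. l \<noteq> 0 \<Longrightarrow> f l = g l"
  shows "bundle_iso f g (\<lambda>l. mat 1) (\<lambda>k. mat 1)"
  using assms by (auto simp: bundle_iso_def invertible_def)

lemma Zfam_0: "l \<noteq> 0 \<Longrightarrow> Zfam 0 l = Osum (vector [-1, 2]) l"
  by (rule ext) (simp add: Zfam_def Osum_def vec_eq_iff forall_2 power_int_minus field_simps)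

lemma bundle_iso_Zfam_0: "bundle_iso (Zfam 0) (Osum (vector [-1, 2])) (\<lambda>l. mat 1) (\<lambda>k. mat 1)"
  by (rule bundle_iso_id) (rule Zfam_0)

lemma linear_minitwistor_coords: "Vector_Spaces.linear (*s) (*s) (minitwistor_coords l)"
  by (rule linear_vecI) (simp_all add: minitwistor_coords_def vec_eq_iff forall_2 algebra_simps)

text \<open>Used for quadratic polynomials in \<open>l\<close> whose constant terms already agree:
  the hypotheses are their values at \<open>1\<close> and \<open>-1\<close>, up to that
  term.\<close>

lemma sum_difference_unique:
  fixes a b c d :: complex
  assumes "a - 2 * b = c - 2 * d" "a + 2 * b = c + 2 * d"
  shows "a = c" "b = d"
proof -
  have "2 * a = (a - 2 * b) + (a + 2 * b)" "4 * b = (a + 2 * b) - (a - 2 * b)"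
    by simp_all
  then show "a = c" "b = d"
    unfolding assms by simp_all
qed

lemma linear_coordinates_minitwistor: "linear_coordinates (Zfam 0) minitwistor_coords"
proof -
  have "bij_betw (\<lambda>x l. minitwistor_coords l x) UNIV (global_sections (Osum (vector [-1, 2])))"
    unfolding bij_betw_def
  proof
    show "inj (\<lambda>x l. minitwistor_coords l x)"
    proof
      fix x y assume "(\<lambda>l. minitwistor_coords l x) = (\<lambda>l. minitwistor_coords l y)"
      then have *: "x $ 1 * l ^ 2 - 2 * x $ 2 * l - x $ 3 = y $ 1 * l ^ 2 - 2 * y $ 2 * l - y $ 3" for l
        by (metis minitwistor_coords_def vector_2(2))
      show "x = y"
        using *[of 0] *[of 1] *[of "-1"] sum_difference_unique[of "x $ 1" "x $ 2" "y $ 1" "y $ 2"]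
        by (simp add: vec_eq_iff forall_3)
    qed
    show "range (\<lambda>x l. minitwistor_coords l x) = global_sections (Osum (vector [-1, 2]))"
    proof (intro equalityI subsetI)
      fix s assume "s \<in> range (\<lambda>x l. minitwistor_coords l x)"
      then obtain x where s: "s = (\<lambda>l. minitwistor_coords l x)"
        by blast
      have "\<forall>i. (\<lambda>l. minitwistor_coords l x $ i) holomorphic_on UNIV"
        unfolding forall_2 minitwistor_coords_def vector_2 by (intro conjI holomorphic_intros)
      \<comment> \<open>The same section in the second chart: multiplying the quadratic by
        \<open>l\<close> to the power \<open>-2\<close> reverses the order of its
        coefficients.\<close>
      moreover have "\<forall>i. (\<lambda>k. (vector [0, x $ 1 - 2 * x $ 2 * k - x $ 3 * k ^ 2] :: complex^2) $ i) holomorphic_on UNIV"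
        unfolding forall_2 vector_2 by (intro conjI holomorphic_intros)
      moreover have "\<forall>l. l \<noteq> 0 \<longrightarrow> vector [0, x $ 1 - 2 * x $ 2 * (1 / l) - x $ 3 * (1 / l) ^ 2] =
          Osum (vector [-1, 2]) l (minitwistor_coords l x)"
        by (simp add: Osum_def minitwistor_coords_def vec_eq_iff forall_2 power_int_minus field_simps power2_eq_square)
      ultimately show "s \<in> global_sections (Osum (vector [-1, 2]))"
        unfolding s global_sections_def mem_Collect_eq
        by (intro conjI exI[of _ "\<lambda>k. vector [0, x $ 1 - 2 * x $ 2 * k - x $ 3 * k ^ 2]"])
    next
      fix s assume s: "s \<in> global_sections (Osum (vector [-1, 2]))"
      obtain a where a: "\<And>l. s l $ 2 = (\<Sum>j\<le>2. a j * l ^ j)"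
        using Osum_section_polynomial[OF s, of 2 2] by auto
      \<comment> \<open>The first component is a section of degree \<open>-1\<close>, hence zero.
        The factor \<open>-1 / 2\<close> and the sign match the convention for the linear and
        constant terms of \<open>Q\<close>.\<close>
      have "s l = minitwistor_coords l (vector [a 2, - a 1 / 2, - a 0])" for l
        using Osum_section_eq_0[OF s, of 1 l]
        by (simp add: vec_eq_iff forall_2 minitwistor_coords_def a numeral_2_eq_2 algebra_simps)
      then show "s \<in> range (\<lambda>x l. minitwistor_coords l x)"
        by (intro image_eqI[of _ _ "vector [a 2, - a 1 / 2, - a 0]"]) auto
    qed
  qed
  then have "linear_coordinates (Osum (vector [-1, 2])) minitwistor_coords"
    by (simp add: linear_coordinates_def linear_minitwistor_coords)
  from bundle_iso_linear_coordinates[OF bundle_iso_id this, of "Zfam 0"]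
  show ?thesis
    by (simp add: Zfam_0)
qed

text \<open>A splitting refers to the patching matrix only at \<open>l \<noteq> 0\<close>, where the
  two patchings coincide.\<close>

lemma normal_splitting_minitwistor:
  "normal_splitting (Zfam 0) minitwistor_coords n H Hh \<longleftrightarrow>
     normal_splitting (Osum (vector [-1, 2])) minitwistor_coords n H Hh"
  unfolding normal_splitting_def normal_patching_linear[OF linear_Zfam] normal_patching_linear[OF linear_Osum]
  by (simp add: Zfam_0 cong: imp_cong)

lemma minitwistor_frame:
  assumes split: "normal_splitting (Zfam 0) minitwistor_coords (vector [-1, 2]) H Hh"
  obtains \<kappa> where "holomorphic_M \<kappa>" "\<And>x. \<kappa> x \<noteq> 0"
    "\<And>l x a. frame_section minitwistor_coords H l x $ 2 $ a =
       \<kappa> x * (axis 1 1 $ a * l ^ 2 - 2 * axis 2 1 $ a * l - axis 3 1 $ a)"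
proof -
  let ?v = "frame_section minitwistor_coords H"
  note split' = split[unfolded normal_splitting_minitwistor]
  note entries = normal_splitting_Osum_entries[OF split']
  have UM: "holomorphic_UM (\<lambda>l x. H l x $ i $ j)" "holomorphic_UM (\<lambda>l x. Hh l x $ i $ j)" for i j
    using split by (simp_all add: normal_splitting_def)
  note hol = UM[THEN holomorphic_UM_fibre]
  \<comment> \<open>This entry is a section of degree \<open>-1 - 2 = -3\<close>, which explains the
    exponent; the entry \<open>2\<close>, \<open>2\<close> below has degree zero.\<close>
  have H12: "H l x $ 1 $ 2 = 0" for l x
  proof (rule entire_eq_zero[OF hol])
    show "l ^ 3 * H l x $ 1 $ 2 = Hh (1 / l) x $ 1 $ 2" if "l \<noteq> 0" for l
      using entries[OF that, of 1 x 2] that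
      by (simp add: power_int_minus field_simps power2_eq_square power3_eq_cube)
  qed simp
  have H22: "H l x $ 2 $ 2 = H 0 x $ 2 $ 2" for l x
  proof (rule entire_constant[OF hol])
    show "H l x $ 2 $ 2 = Hh (1 / l) x $ 2 $ 2" if "l \<noteq> 0" for l
      using entries[OF that, of 2 x 2] that by simp
  qed
  \<comment> \<open>Triangularity makes the determinant the product of the diagonal entries.\<close>
  have nz: "H l x $ 1 $ 1 \<noteq> 0" "H l x $ 2 $ 2 \<noteq> 0" for l x
    using split invertible_det_nz[of "H l x"] by (auto simp: normal_splitting_def det_2 H12)
  have prod: "H l x $ i $ 1 * ?v l x $ 1 $ a + H l x $ i $ 2 * ?v l x $ 2 $ a = minitwistor_coords l (axis a 1) $ i"
    for l x i a
  proof -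
    have "(H l x ** ?v l x) $ i $ a = matrix (minitwistor_coords l) $ i $ a"
      by (simp add: frame_section_mult[OF split] dw_linear linear_minitwistor_coords)
    then show ?thesis
      by (simp add: matrix_matrix_mult_def sum_2 matrix_def)
  qed
  \<comment> \<open>The first row of \<open>H v = dw\<close> reads \<open>H11 v1 = 0\<close>, as
    \<open>\<zeta>\<close> vanishes on every section.\<close>
  have v1: "?v l x $ 1 $ a = 0" for l x a
    using prod[of l x 1 a] nz by (simp add: H12 minitwistor_coords_def)
  define \<kappa> where "\<kappa> x = inverse (H 0 x $ 2 $ 2)" for x
  have v2: "?v l x $ 2 $ a = \<kappa> x * (axis 1 1 $ a * l ^ 2 - 2 * axis 2 1 $ a * l - axis 3 1 $ a)" for l x a
  proof -
    have "H 0 x $ 2 $ 2 * ?v l x $ 2 $ a = axis a 1 $ 1 * l ^ 2 - 2 * axis a 1 $ 2 * l - axis a 1 $ 3"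
      using prod[of l x 2 a] by (simp add: v1 H22[of l] minitwistor_coords_def)
    then show ?thesis
      using nz(2)[of 0 x] by (simp add: \<kappa>_def axis_def field_simps)
  qed
  show ?thesis
  proof (rule that[OF _ _ v2])
    show "holomorphic_M \<kappa>"
      unfolding \<kappa>_def by (intro holomorphic_M_inverse nz holomorphic_UM_base[OF UM(1)])
    show "\<kappa> x \<noteq> 0" for x
      using nz by (simp add: \<kappa>_def)
  qed
qed

lemma minitwistor_form_scale:
  "minitwistor_form (c *s e00) (c *s e01) (c *s e11) = (\<chi> a b. (c * c) * minitwistor_form e00 e01 e11 $ a $ b)"
  by (simp add: minitwistor_form_def vec_eq_iff field_simps)

text \<open>Nowhere vanishing holomorphic factors are closed under products and inverses, so a
  rescaling of the representative is absorbed.\<close>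

lemma conformal_class_rescale:
  assumes "holomorphic_M \<phi>" "\<And>x. \<phi> x \<noteq> 0" "\<And>x. g x = (\<chi> a b. \<phi> x * g0 x $ a $ b)"
  shows "conformal_class g = conformal_class g0"
proof (intro equalityI subsetI)
  fix g' assume "g' \<in> conformal_class g"
  then obtain \<psi> where \<psi>: "holomorphic_M \<psi>" "\<And>x. \<psi> x \<noteq> 0" "\<And>x. g' x = (\<chi> a b. \<psi> x * g x $ a $ b)"
    unfolding conformal_class_def by blast
  show "g' \<in> conformal_class g0"
    unfolding conformal_class_def mem_Collect_eq
    by (rule exI[of _ "\<lambda>x. \<psi> x * \<phi> x"]) (simp add: \<psi> assms holomorphic_M_mult mult.assoc)
next
  fix g' assume "g' \<in> conformal_class g0"
  then obtain \<psi> where \<psi>: "holomorphic_M \<psi>" "\<And>x. \<psi> x \<noteq> 0" "\<And>x. g' x = (\<chi> a b. \<psi> x * g0 x $ a $ b)"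
    unfolding conformal_class_def by blast
  have "g' x = (\<chi> a b. (\<psi> x * inverse (\<phi> x)) * g x $ a $ b)" for x
    using assms(2)[of x] by (simp add: \<psi>(3) assms(3) vec_eq_iff)
  then show "g' \<in> conformal_class g"
    unfolding conformal_class_def mem_Collect_eq
    by (intro exI[of _ "\<lambda>x. \<psi> x * inverse (\<phi> x)"])
      (simp add: \<psi> assms(1,2) holomorphic_M_mult holomorphic_M_inverse)
qed

lemma minitwistor_metric_exists_conformal:
  assumes split: "normal_splitting (Zfam 0) minitwistor_coords (vector [-1, 2]) H Hh"
  shows "\<exists>g. minitwistor_metric minitwistor_coords H g"
    and "minitwistor_metric minitwistor_coords H g \<Longrightarrow>
      nondegenerate g \<and> conformal_class g = conformal_class flat_metric"
proof -
  obtain \<kappa> where \<kappa>: "holomorphic_M \<kappa>" "\<And>x. \<kappa> x \<noteq> 0"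
    and v: "\<And>l x a. frame_section minitwistor_coords H l x $ 2 $ a =
       \<kappa> x * (axis 1 1 $ a * l ^ 2 - 2 * axis 2 1 $ a * l - axis 3 1 $ a)"
    using minitwistor_frame[OF split] by blast
  show "\<exists>g. minitwistor_metric minitwistor_coords H g"
    unfolding minitwistor_metric_def v
    by (intro exI[of _ "\<lambda>x. minitwistor_form (\<kappa> x *s axis 1 1) (\<kappa> x *s axis 2 1) (\<kappa> x *s axis 3 1)"]
        exI[of _ "\<lambda>x. \<kappa> x *s axis 1 1"] exI[of _ "\<lambda>x. \<kappa> x *s axis 2 1"] exI[of _ "\<lambda>x. \<kappa> x *s axis 3 1"])
      (simp add: algebra_simps)
  assume "minitwistor_metric minitwistor_coords H g"
  then obtain e00 e01 e11 :: "complex^3 \<Rightarrow> complex^3" where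
    e: "\<And>l x a. \<kappa> x * (axis 1 1 $ a * l ^ 2 - 2 * axis 2 1 $ a * l - axis 3 1 $ a) =
        e00 x $ a * l ^ 2 - 2 * e01 x $ a * l - e11 x $ a"
    and g: "\<And>x. g x = minitwistor_form (e00 x) (e01 x) (e11 x)"
    unfolding minitwistor_metric_def v by blast
  \<comment> \<open>The value at \<open>l = 0\<close> fixes \<open>e11\<close>; the values at
    \<open>1\<close> and \<open>-1\<close> then separate \<open>e00\<close> from \<open>e01\<close>.
    Hence the metric is determined by \<open>H\<close>, which enters only through
    \<open>\<kappa>\<close>.\<close>
  have e11: "e11 x = \<kappa> x *s axis 3 1" for x
    using e[of x _ 0] by (simp add: vec_eq_iff)
  have *: "\<kappa> x * axis 1 1 $ a - 2 * (\<kappa> x * axis 2 1 $ a) = e00 x $ a - 2 * e01 x $ a"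
    "\<kappa> x * axis 1 1 $ a + 2 * (\<kappa> x * axis 2 1 $ a) = e00 x $ a + 2 * e01 x $ a" for x a
    using e[of x a 1] e[of x a "-1"] by (simp_all add: e11 algebra_simps)
  have e00: "e00 x = \<kappa> x *s axis 1 1" and e01: "e01 x = \<kappa> x *s axis 2 1" for x
    unfolding vec_eq_iff vector_smult_component using sum_difference_unique[OF *] by auto
  have g': "g x = (\<chi> a b. (\<kappa> x * \<kappa> x) * flat_metric x $ a $ b)" for x
    by (simp add: g e00 e01 e11 minitwistor_form_scale flat_metric_def)
  \<comment> \<open>The flat form has determinant \<open>-1/4\<close>, so this one is
    \<open>-1/4\<close> times the sixth power of \<open>\<kappa> x\<close>.\<close>
  have "det (g x) \<noteq> 0" for x
    using \<kappa>(2)[of x] by (simp add: det_3 g' flat_metric_def minitwistor_form_def axis_def)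
  then have "nondegenerate g"
    by (simp add: nondegenerate_def invertible_det_nz)
  moreover have "conformal_class g = conformal_class flat_metric"
    by (intro conformal_class_rescale[OF _ _ g'] holomorphic_M_mult) (simp_all add: \<kappa>)
  ultimately show "nondegenerate g \<and> conformal_class g = conformal_class flat_metric"
    by blast
qed

subsection \<open>Newton-Cartan structures\<close>

text \<open>In the second chart the new coordinates are \<open>\<zeta>h\<close> and
  \<open>k ^ 2 * \<zeta>h - \<epsilon> * Qh\<close>; the \<open>Q\<close> terms cancel, leaving
  \<open>\<zeta> / l\<close>. Both matrices have determinant \<open>- \<epsilon>\<close>, which is
  where \<open>\<epsilon> \<noteq> 0\<close> enters.\<close>

lemma bundle_iso_Zfam:
  assumes "\<epsilon> \<noteq> 0"
  shows "bundle_iso (Zfam \<epsilon>) (Osum (vector [0, 1]))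
    (\<lambda>l. vector [vector [l, \<epsilon>], vector [1, 0]]) (\<lambda>k. vector [vector [1, 0], vector [k ^ 2, - \<epsilon>]])"
proof -
  have "\<forall>i j. (\<lambda>l. (vector [vector [l, \<epsilon>], vector [1, 0]] :: complex^2^2) $ i $ j) holomorphic_on UNIV"
    "\<forall>i j. (\<lambda>k. (vector [vector [1, 0], vector [k ^ 2, - \<epsilon>]] :: complex^2^2) $ i $ j) holomorphic_on UNIV"
    unfolding forall_2 vector_2 by (intro conjI holomorphic_intros)+
  then show ?thesis
    unfolding bundle_iso_def
    using assms
    by (simp add: invertible_det_nz det_2 Zfam_def Osum_def vec_eq_iff forall_2 matrix_vector_mult_def sum_2
        power_int_minus field_simps power2_eq_square)
qed

lemma linear_coordinates_Osum_0_1: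
  "linear_coordinates (Osum (vector [0, 1])) (\<lambda>l x. vector [x $ 1, x $ 2 + l * x $ 3])"
proof -
  let ?w = "\<lambda>l (x :: complex^3). vector [x $ 1, x $ 2 + l * x $ 3] :: complex^2"
  have "bij_betw (\<lambda>x l. ?w l x) UNIV (global_sections (Osum (vector [0, 1])))"
    unfolding bij_betw_def
  proof
    show "inj (\<lambda>x l. ?w l x)"
    proof
      fix x y :: "complex^3" assume *: "(\<lambda>l. ?w l x) = (\<lambda>l. ?w l y)"
      have "x $ 1 = y $ 1 \<and> x $ 2 + l * x $ 3 = y $ 2 + l * y $ 3" for l
        using fun_cong[OF *, of l] by (simp add: vec_eq_iff forall_2)
      from this[of 0] this[of 1] show "x = y"
        by (simp add: vec_eq_iff forall_3)
    qed
    show "range (\<lambda>x l. ?w l x) = global_sections (Osum (vector [0, 1]))"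
    proof (intro equalityI subsetI)
      fix s assume "s \<in> range (\<lambda>x l. ?w l x)"
      then obtain x :: "complex^3" where s: "s = (\<lambda>l. ?w l x)"
        by blast
      have "\<forall>i. (\<lambda>l. ?w l x $ i) holomorphic_on UNIV"
        "\<forall>i. (\<lambda>k. (vector [x $ 1, x $ 2 * k + x $ 3] :: complex^2) $ i) holomorphic_on UNIV"
        unfolding forall_2 vector_2 by (intro conjI holomorphic_intros)+
      moreover have "\<forall>l. l \<noteq> 0 \<longrightarrow> vector [x $ 1, x $ 2 * (1 / l) + x $ 3] = Osum (vector [0, 1]) l (?w l x)"
        by (simp add: Osum_def vec_eq_iff forall_2 power_int_minus field_simps)
      ultimately show "s \<in> global_sections (Osum (vector [0, 1]))"
        unfolding s global_sections_def mem_Collect_eq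
        by (intro conjI exI[of _ "\<lambda>k. vector [x $ 1, x $ 2 * k + x $ 3]"])
    next
      fix s assume s: "s \<in> global_sections (Osum (vector [0, 1]))"
      obtain a where a: "\<And>l. s l $ 1 = a"
        using Osum_section_polynomial[OF s, of 1 0] by auto
      obtain b where b: "\<And>l. s l $ 2 = (\<Sum>j\<le>1. b j * l ^ j)"
        using Osum_section_polynomial[OF s, of 2 1] by auto
      have "s l = ?w l (vector [a, b 0, b 1] :: complex^3)" for l
        by (simp add: vec_eq_iff forall_2 a b algebra_simps)
      then show "s \<in> range (\<lambda>x l. ?w l x)"
        by (intro image_eqI[of _ _ "vector [a, b 0, b 1]"]) auto
    qed
  qed
  moreover have "Vector_Spaces.linear (*s) (*s) (\<lambda>x. ?w l x)" for l
    by (rule linear_vecI) (simp_all add: vec_eq_iff forall_2 algebra_simps)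
  ultimately show ?thesis
    by (simp add: linear_coordinates_def)
qed

section \<open>Nondegeneracy and existence of the induced structures\<close>

lemma constant_section_Osum_0_1: "(\<lambda>l. u) \<in> global_sections (Osum (vector [0, 1]))"
proof -
  have "\<forall>i. (\<lambda>k. (vector [u $ 1, u $ 2 * k] :: complex^2) $ i) holomorphic_on UNIV"
    unfolding forall_2 vector_2 by (intro conjI holomorphic_intros)
  moreover have "\<forall>l. l \<noteq> 0 \<longrightarrow> vector [u $ 1, u $ 2 * (1 / l)] = Osum (vector [0, 1]) l u"
    by (simp add: Osum_def vec_eq_iff forall_2 power_int_minus field_simps)
  ultimately show ?thesis
    unfolding global_sections_def mem_Collect_eq by (intro conjI exI[of _ "\<lambda>k. vector [u $ 1, u $ 2 * k]"]) simp_all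
qed

lemma frame_section_row_nonzero:
  assumes w: "linear_coordinates (Osum (vector [0, 1])) w" and H: "invertible (H l x)"
  shows "frame_section w H l x $ i \<noteq> 0"
proof
  assume zero: "frame_section w H l x $ i = 0"
  have lin: "Vector_Spaces.linear (*s) (*s) (w l)"
    using w by (simp add: linear_coordinates_def)
  \<comment> \<open>Some section takes the value \<open>H l x *v axis i 1\<close> over
    \<open>l\<close>; since \<open>w\<close> is linear in the section, \<open>dw\<close> applied to
    it returns this value, so the frame sends it to \<open>axis i 1\<close>.\<close>
  have "(\<lambda>m. H l x *v axis i 1) \<in> range (\<lambda>y m. w m y)"
    using w constant_section_Osum_0_1 by (auto simp: linear_coordinates_def bij_betw_def)
  then obtain y where "w l y = H l x *v axis i 1"
    by (metis (mono_tags, lifting) imageE)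
  then have "frame_section w H l x *v y = axis i 1"
    by (simp add: frame_section_def dw_linear[of w l, OF lin] matrix_vector_mul_assoc[symmetric] matrix_works[OF lin]
        matrix_inv_vector[OF H])
  moreover have "(frame_section w H l x *v y) $ i = 0"
    by (simp add: matrix_vector_mult_def zero)
  ultimately show False
    by simp
qed

lemma induced_structure_newton_cartan:
  assumes w: "linear_coordinates (Osum (vector [0, 1])) w"
    and ind: "(h, \<theta>, \<Gamma>) \<in> induced_structures (Osum (vector [0, 1])) w"
  shows "newton_cartan h \<theta> \<Gamma>"
proof -
  obtain H Hh where split: "normal_splitting (Osum (vector [0, 1])) w (vector [0, 1]) H Hh"
    and \<theta>: "\<And>l x. frame_section w H l x $ 1 = \<theta> x"
    using ind by (auto simp: induced_structures_def)
  have nz: "\<theta> x \<noteq> 0" for x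
    using frame_section_row_nonzero[OF w, of H 0 x 1] split by (simp add: \<theta> normal_splitting_def)
  have h: "symmetric_rank_two h" "\<And>x. h x *v \<theta> x = 0" and tf: "torsion_free \<Gamma>" and par: "parallel_form \<Gamma> \<theta>"
    using ind by (auto simp: induced_structures_def Lambda_connection_def)
  \<comment> \<open>Parallelism expresses the derivative of \<open>\<theta>\<close> through
    \<open>\<Gamma>\<close>, whose symmetry in the lower indices then gives closedness.\<close>
  have "pd b (\<lambda>y. \<theta> y $ c) x = (\<Sum>a\<in>UNIV. \<Gamma> x a b c * \<theta> x $ a)" for x b c
    using par by (simp add: parallel_form_def)
  moreover have "\<Gamma> x a b c = \<Gamma> x a c b" for x a b c
    using tf unfolding torsion_free_def by blast
  ultimately have "closed_form \<theta>"
    unfolding closed_form_def by simp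
  moreover have "{\<alpha>. h x *v \<alpha> = 0} = {c *s \<theta> x | c. True}" for x
    using rank_two_kernel[OF _ nz[of x], of "h x"] h by (simp add: symmetric_rank_two_def)
  ultimately show ?thesis
    using ind nz tf by (simp add: newton_cartan_def induced_structures_def)
qed

lemma induced_structures_nonempty:
  assumes w: "linear_coordinates (Osum (vector [0, 1])) w"
  shows "induced_structures (Osum (vector [0, 1])) w \<noteq> {}"
proof -
  let ?H = "\<lambda>l x. mat 1 :: complex^2^2"
  have lin: "Vector_Spaces.linear (*s) (*s) (w l)" for l
    using w by (simp add: linear_coordinates_def)
  have inv: "invertible (mat 1 :: complex^2^2)" "matrix_inv (mat 1 :: complex^2^2) = mat 1"
    by (auto simp: invertible_def intro: matrix_inv_eqI)
  \<comment> \<open>With the identity splitting the frame is \<open>dw\<close> itself. Its first row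
    belongs to the trivial summand and so does not depend on \<open>l\<close>; evaluation at
    \<open>0\<close> is a choice.\<close>
  define \<theta> where "\<theta> = matrix (w 0) $ 1"
  have frame: "frame_section w ?H l x $ 1 = \<theta>" for l x
  proof -
    have "w l (axis a 1) $ 1 = w 0 (axis a 1) $ 1" for a
    proof -
      have "(\<lambda>l. w l (axis a 1)) \<in> global_sections (Osum (vector [0, 1]))"
        using w by (auto simp: linear_coordinates_def bij_betw_def)
      from Osum_section_polynomial[OF this, of 1 0] show ?thesis
        by auto
    qed
    then show ?thesis
      by (simp add: \<theta>_def frame_section_def inv dw_linear lin matrix_def vec_eq_iff)
  qed
  then have "\<theta> \<noteq> 0"
    using frame_section_row_nonzero[OF w, of ?H 0 0 1] inv(1) by simp
  then obtain h where h: "transpose h = h" "rank h = 2" "h *v \<theta> = 0"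
    by (rule rank_two_annihilator)
  \<comment> \<open>The choice \<open>\<sigma> = \<sigma>h = 0\<close> solves the homogeneous
    splitting equation and gives \<open>\<Gamma> = 0\<close>, for which constant tensors are
    parallel.\<close>
  have "Lambda_connection (Osum (vector [0, 1])) w (\<lambda>x a b c. 0)"
  proof -
    have "w l (\<chi> a. 0) = 0" for l
    proof -
      interpret Vector_Spaces.linear "(*s)" "(*s)" "w l"
        by (rule lin)
      show ?thesis
        using zero by (simp add: zero_vec_def)
    qed
    then show ?thesis
      unfolding Lambda_connection_linear[OF lin] sigma_splitting_linear[OF linear_Osum]
      by (intro conjI exI[of _ "\<lambda>l x \<mu> \<nu> \<rho>. 0"])
        (simp_all add: torsion_free_def holomorphic_UM_const bilin_def zero_vec_def[symmetric])
  qed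
  then have "((\<lambda>x. h), (\<lambda>x. \<theta>), (\<lambda>x a b c. 0)) \<in> induced_structures (Osum (vector [0, 1])) w"
    using h frame normal_splitting_Osum[of "vector [0, 1]" w]
    by (auto simp: induced_structures_def holomorphic_triple_def holomorphic_M_const
        parallel_form_def parallel_bivector_def symmetric_rank_two_def)
  then show ?thesis
    by blast
qed

theorem theorem3p4:
  shows "(isomorphic_bundles (Zfam 0) (Osum (vector [-1, 2])) \<and>
          linear_coordinates (Zfam 0) minitwistor_coords \<and>
          (\<exists>H Hh. normal_splitting (Zfam 0) minitwistor_coords (vector [-1, 2]) H Hh) \<and>
          (\<forall>H Hh. normal_splitting (Zfam 0) minitwistor_coords (vector [-1, 2]) H Hh \<longrightarrow>
             (\<exists>g. minitwistor_metric minitwistor_coords H g) \<and>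
             (\<forall>g. minitwistor_metric minitwistor_coords H g \<longrightarrow>
                nondegenerate g \<and> conformal_class g = conformal_class flat_metric)))
       \<and> (\<forall>\<epsilon>::complex. \<epsilon> \<noteq> 0 \<longrightarrow>
            isomorphic_bundles (Zfam \<epsilon>) (Osum (vector [0, 1])) \<and>
            (\<exists>w. linear_coordinates (Zfam \<epsilon>) w) \<and>
            (\<forall>w. linear_coordinates (Zfam \<epsilon>) w \<longrightarrow>
               induced_structures (Zfam \<epsilon>) w \<noteq> {} \<and>
               (\<forall>(h, \<theta>, \<Gamma>) \<in> induced_structures (Zfam \<epsilon>) w. newton_cartan h \<theta> \<Gamma>) \<and>
               (\<forall>P Ph. bundle_iso (Zfam \<epsilon>) (Osum (vector [0, 1])) P Ph \<longrightarrow>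
                  induced_structures (Zfam \<epsilon>) w =
                  induced_structures (Osum (vector [0, 1])) (\<lambda>l x. P l *v w l x))))"
proof (intro conjI allI impI)
  show "isomorphic_bundles (Zfam 0) (Osum (vector [-1, 2]))"
    unfolding isomorphic_bundles_def using bundle_iso_Zfam_0 by blast
  show "linear_coordinates (Zfam 0) minitwistor_coords"
    by (rule linear_coordinates_minitwistor)
  show "\<exists>H Hh. normal_splitting (Zfam 0) minitwistor_coords (vector [-1, 2]) H Hh"
    unfolding normal_splitting_minitwistor using normal_splitting_Osum by blast
next
  fix H Hh assume split: "normal_splitting (Zfam 0) minitwistor_coords (vector [-1, 2]) H Hh"
  show "\<exists>g. minitwistor_metric minitwistor_coords H g"
    by (rule minitwistor_metric_exists_conformal(1)[OF split])
  fix g assume "minitwistor_metric minitwistor_coords H g"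
  from minitwistor_metric_exists_conformal(2)[OF split this]
  show "nondegenerate g" "conformal_class g = conformal_class flat_metric"
    by blast+
next
  fix \<epsilon> :: complex assume "\<epsilon> \<noteq> 0"
  then obtain P Ph where iso: "bundle_iso (Zfam \<epsilon>) (Osum (vector [0, 1])) P Ph"
    using bundle_iso_Zfam by blast
  then show "isomorphic_bundles (Zfam \<epsilon>) (Osum (vector [0, 1]))"
    unfolding isomorphic_bundles_def by blast
  show "\<exists>w. linear_coordinates (Zfam \<epsilon>) w"
    using bundle_iso_linear_coordinates[OF bundle_iso_sym[OF iso] linear_coordinates_Osum_0_1] by blast
  fix w assume w: "linear_coordinates (Zfam \<epsilon>) w"
  then have lin: "\<And>l. Vector_Spaces.linear (*s) (*s) (w l)"
    by (simp add: linear_coordinates_def)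
  \<comment> \<open>The isomorphism is left open here: \<open>eq\<close> serves both the one just
    obtained, to reduce to the sum of line bundles, and the arbitrary one in the last claim.\<close>
  note eq = induced_structures_bundle_iso[OF linear_Zfam linear_Osum lin]
  note w' = bundle_iso_linear_coordinates[OF iso w]
  show "induced_structures (Zfam \<epsilon>) w \<noteq> {}"
    unfolding eq[OF iso] by (rule induced_structures_nonempty[OF w'])
  show "\<forall>(h, \<theta>, \<Gamma>) \<in> induced_structures (Zfam \<epsilon>) w. newton_cartan h \<theta> \<Gamma>"
    unfolding eq[OF iso] using induced_structure_newton_cartan[OF w'] by blast
  fix P Ph assume "bundle_iso (Zfam \<epsilon>) (Osum (vector [0, 1])) P Ph"
  then show "induced_structures (Zfam \<epsilon>) w =
      induced_structures (Osum (vector [0, 1])) (\<lambda>l x. P l *v w l x)"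
    by (rule eq)
qed

end
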